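(* Every parallelotope is of Jensen-type: for every $n$-dimensional parallelotope $W\subset\mathbb{R}^n$ and every convex function $f\colon W\to\mathbb{R}$, $$\frac{1}{|W|}\int_W f(x)\,dx \le \frac{1}{|\partial W|}\int_{\partial W} f(x)\,dx .$$
   Context: An $n$-dimensional parallelotope is a set $\{p+\sum_{i=1}^n t_i u_i : t_i\in[0,1]\}$ with $p\in\mathbb{R}^n$ and $u_1,\dots,u_n\in\mathbb{R}^n$ linearly independent. $|W|$ is the $n$-dimensional Lebesgue measure of $W$, $|\partial W|$ is the $(n-1)$-dimensional (surface/Hausdorff) measure of the boundary $\partial W$; integrals over $W$ and $\partial W$ are with respect to these measures. A convex closed shape $X$ is called of Jensen-type if $\frac{1}{|X|}\int_X f\,dx\le\frac{1}{|\partial X|}\int_{\partial X} f\,dx$ for every convex function $f\colon X\to\mathbb{R}$. *)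

theory Defs
  imports "HOL-Analysis.Analysis"
begin

section \<open>Hausdorff measure\<close>

text \<open>
  The diameter gauge, normalised so that on \<open>d\<close>-dimensional Euclidean space the \<open>d\<close>-dimensional
  Hausdorff measure agrees with Lebesgue measure. The empty set has to be treated separately:
  for \<open>d = 0\<close> a point has weight \<open>0 ^ 0 = 1\<close> (so that one obtains counting measure), while the
  empty set must have weight \<open>0\<close>.
\<close>

definition hausdorff_gauge :: "nat \<Rightarrow> 'a::metric_space set \<Rightarrow> ennreal" where
  "hausdorff_gauge d C =
     (if C = {} then 0 else ennreal (unit_ball_vol (real d) * (diameter C / 2) ^ d))"

text \<open>
  Boundedness is required explicitly because \<^const>\<open>diameter\<close> is real-valued and unspecified on
  unbounded sets.
\<close>

definition hausdorff_covers :: "real \<Rightarrow> 'a::metric_space set \<Rightarrow> (nat \<Rightarrow> 'a set) set" where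
  "hausdorff_covers \<delta> A =
     {C. A \<subseteq> (\<Union>i. C i) \<and> (\<forall>i. bounded (C i) \<and> diameter (C i) \<le> \<delta>)}"

definition hausdorff_content :: "nat \<Rightarrow> real \<Rightarrow> 'a::metric_space set \<Rightarrow> ennreal" where
  "hausdorff_content d \<delta> A = (INF C\<in>hausdorff_covers \<delta> A. \<Sum>i. hausdorff_gauge d (C i))"

definition hausdorff_outer :: "nat \<Rightarrow> 'a::metric_space set \<Rightarrow> ennreal" where
  "hausdorff_outer d A = (SUP \<delta>\<in>{0<..}. hausdorff_content d \<delta> A)"

definition hausdorff_measure :: "nat \<Rightarrow> 'a::metric_space measure" where
  "hausdorff_measure d =
     measure_of UNIV (lambda_system UNIV UNIV (hausdorff_outer d)) (hausdorff_outer d)"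

lemma hausdorff_content_subadditive:
  fixes A :: "nat \<Rightarrow> 'a::metric_space set"
  shows "hausdorff_content d \<delta> (\<Union>i. A i) \<le> (\<Sum>i. hausdorff_content d \<delta> (A i))"
proof (rule ennreal_le_epsilon)
  fix e :: real
  assume fin: "(\<Sum>i. hausdorff_content d \<delta> (A i)) < top" and e: "0 < e"
  have fi: "hausdorff_content d \<delta> (A i) \<noteq> top" for i
    using ennreal_suminf_lessD[OF fin, of i] by simp
  have "\<exists>C\<in>hausdorff_covers \<delta> (A i). (\<Sum>j. hausdorff_gauge d (C j)) <
          hausdorff_content d \<delta> (A i) + ennreal (e * (1/2) ^ Suc i)" for i
  proof -
    have "hausdorff_content d \<delta> (A i) < hausdorff_content d \<delta> (A i) + ennreal (e * (1/2) ^ Suc i)"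
      using fi[of i] e by (auto simp: ennreal_add_left_cancel_less[of _ 0, simplified])
    then show ?thesis
      by (subst (asm) (1) hausdorff_content_def) (simp add: INF_less_iff)
  qed
  then obtain C where C: "\<And>i. C i \<in> hausdorff_covers \<delta> (A i)"
    and le: "\<And>i. (\<Sum>j. hausdorff_gauge d (C i j)) <
          hausdorff_content d \<delta> (A i) + ennreal (e * (1/2) ^ Suc i)"
    by metis
  define D where "D = (\<lambda>n. case prod_decode n of (i, j) \<Rightarrow> C i j)"
  have "D \<in> hausdorff_covers \<delta> (\<Union>i. A i)"
  proof -
    have "(\<Union>i. A i) \<subseteq> (\<Union>n. D n)"
    proof
      fix x assume "x \<in> (\<Union>i. A i)"
      then obtain i j where "x \<in> C i j"
        using C unfolding hausdorff_covers_def by blast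
      then have "x \<in> D (prod_encode (i, j))" by (simp add: D_def)
      then show "x \<in> (\<Union>n. D n)" by blast
    qed
    then show ?thesis
      using C unfolding hausdorff_covers_def by (auto simp: D_def split: prod.split)
  qed
  then have "hausdorff_content d \<delta> (\<Union>i. A i) \<le> (\<Sum>n. hausdorff_gauge d (D n))"
    unfolding hausdorff_content_def by (rule INF_lower)
  also have "\<dots> = (\<Sum>i. \<Sum>j. hausdorff_gauge d (C i j))"
    using suminf_ennreal_2dimen[of "\<lambda>i. \<Sum>j. hausdorff_gauge d (C i j)"
        "\<lambda>(i, j). hausdorff_gauge d (C i j)"]
    by (simp add: D_def comp_def split_beta)
  also have "\<dots> \<le> (\<Sum>i. hausdorff_content d \<delta> (A i) + ennreal (e * (1/2) ^ Suc i))"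
    using le by (intro suminf_le) (auto intro: less_imp_le)
  also have "\<dots> = (\<Sum>i. hausdorff_content d \<delta> (A i)) + (\<Sum>i. ennreal (e * (1/2) ^ Suc i))"
    by (rule suminf_add[symmetric]) auto
  also have "(\<Sum>i. ennreal (e * (1/2) ^ Suc i)) = ennreal e"
    using sums_mult[OF power_half_series, of e] e by (intro suminf_ennreal_eq) auto
  finally show "hausdorff_content d \<delta> (\<Union>i. A i) \<le>
      (\<Sum>i. hausdorff_content d \<delta> (A i)) + ennreal e" .
qed

lemma outer_measure_space_hausdorff_outer:
  "outer_measure_space UNIV (hausdorff_outer d :: 'a::metric_space set \<Rightarrow> ennreal)"
proof -
  have "hausdorff_content d \<delta> ({} :: 'a set) = 0" if "\<delta> > 0" for \<delta>
  proof -
    have "(\<lambda>_. {}) \<in> hausdorff_covers \<delta> ({} :: 'a set)"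
      using that by (simp add: hausdorff_covers_def)
    then have "hausdorff_content d \<delta> ({} :: 'a set) \<le> (\<Sum>i::nat. hausdorff_gauge d ({} :: 'a set))"
      unfolding hausdorff_content_def by (rule INF_lower)
    then show ?thesis by (simp add: hausdorff_gauge_def)
  qed
  then have empty: "hausdorff_outer d ({} :: 'a set) = 0"
    by (simp add: hausdorff_outer_def)
  have mono: "hausdorff_outer d A \<le> hausdorff_outer d B" if "A \<subseteq> B" for A B :: "'a set"
    unfolding hausdorff_outer_def hausdorff_content_def hausdorff_covers_def
    using that by (intro SUP_mono' INF_superset_mono) auto
  have subadd: "hausdorff_outer d (\<Union>i. A i) \<le> (\<Sum>i. hausdorff_outer d (A i))"
    for A :: "nat \<Rightarrow> 'a set"
    unfolding hausdorff_outer_def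
  proof (rule SUP_least)
    fix \<delta> :: real assume \<delta>: "\<delta> \<in> {0<..}"
    have "hausdorff_content d \<delta> (\<Union>i. A i) \<le> (\<Sum>i. hausdorff_content d \<delta> (A i))"
      by (rule hausdorff_content_subadditive)
    also have "\<dots> \<le> (\<Sum>i. SUP \<delta>\<in>{0<..}. hausdorff_content d \<delta> (A i))"
      using \<delta> by (intro suminf_le SUP_upper) auto
    finally show "hausdorff_content d \<delta> (\<Union>i. A i) \<le>
        (\<Sum>i. SUP \<delta>\<in>{0<..}. hausdorff_content d \<delta> (A i))" .
  qed
  show ?thesis
    unfolding outer_measure_space_def positive_def increasing_def countably_subadditive_def
    using empty mono subadd by auto
qed

lemma measure_space_hausdorff:
  "measure_space UNIV (lambda_system UNIV UNIV (hausdorff_outer d))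
     (hausdorff_outer d :: 'a::metric_space set \<Rightarrow> ennreal)"
  using sigma_algebra.caratheodory_lemma[OF sigma_algebra_Pow, of UNIV "hausdorff_outer d :: 'a set \<Rightarrow> ennreal"]
    outer_measure_space_hausdorff_outer[of d, where 'a='a] by simp

lemma space_hausdorff_measure [simp]: "space (hausdorff_measure d) = UNIV"
  by (simp add: hausdorff_measure_def space_measure_of_conv)

lemma sets_hausdorff_measure:
  "sets (hausdorff_measure d :: 'a::metric_space measure) =
     lambda_system UNIV UNIV (hausdorff_outer d)"
  using measure_space_hausdorff[of d, where 'a='a] unfolding hausdorff_measure_def measure_space_def
  by (simp add: sigma_algebra.sigma_sets_eq)

lemma emeasure_hausdorff_measure:
  fixes A :: "'a::metric_space set"
  assumes "A \<in> sets (hausdorff_measure d)"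
  shows "emeasure (hausdorff_measure d) A = hausdorff_outer d A"
  using measure_space_hausdorff[where d=d and 'a='a] assms
  unfolding sets_hausdorff_measure unfolding hausdorff_measure_def measure_space_def
  by (intro emeasure_measure_of_sigma) auto


section \<open>Parallelotopes and shapes of Jensen type\<close>

definition parallelotope :: "(real ^ 'n) set \<Rightarrow> bool" where
  "parallelotope W \<longleftrightarrow>
     (\<exists>(p :: real ^ 'n) (u :: 'n \<Rightarrow> real ^ 'n). inj u \<and> independent (range u) \<and>
        W = {p + (\<Sum>i\<in>UNIV. t i *\<^sub>R u i) | t :: 'n \<Rightarrow> real. \<forall>i. t i \<in> {0..1}})"

abbreviation surface_measure :: "(real ^ 'n) measure" where
  "surface_measure \<equiv> hausdorff_measure (CARD('n) - 1)"

text \<open>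
  Only the values of \<open>f\<close> on \<open>X\<close> matter, since \<open>frontier X \<subseteq> X\<close> for closed \<open>X\<close>. Bochner integrals
  of non-integrable functions are \<open>0\<close> by convention; this does not intervene when \<open>X\<close> is a
  parallelotope, on which convex functions are bounded and Borel measurable.
\<close>

definition jensen_type :: "(real ^ 'n) set \<Rightarrow> bool" where
  "jensen_type X \<longleftrightarrow> convex X \<and> closed X \<and>
     (\<forall>f :: real ^ 'n \<Rightarrow> real. convex_on X f \<longrightarrow>
        1 / measure lebesgue X * (LINT x:X|lebesgue. f x)
          \<le> 1 / measure surface_measure (frontier X) * (LINT x:frontier X|surface_measure. f x))"

end

theory Submission
  imports Defs
begin

text \<open>
  Write the parallelotope as \<open>p + T [0,1]\<^sup>n\<close> with \<open>T\<close> linear and put \<open>h t = f (p + T t)\<close>. For each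
  coordinate \<open>i\<close>, convexity along the edges in direction \<open>i\<close> shows that the mean of \<open>h\<close> over the cube
  is at most the average of its means over the two facets \<open>t\<^sub>i = 0\<close> and \<open>t\<^sub>i = 1\<close>. These two facets
  are translates of each other, so they have the same surface measure, and the mean over the boundary
  is a convex combination, over \<open>i\<close>, of those averages; the weights play no role.

  Hence the constant relating Hausdorff measure on a facet to Lebesgue measure in the coordinates
  \<open>t\<close> need not be computed: translation invariance shows that there is one, and crude covering
  arguments show that it is positive and finite.
\<close>

section \<open>Borel sets are Hausdorff measurable\<close>

text \<open>Two obstacles shape the development. The first is regularity: a convex function on the
  parallelotope is continuous in its interior and, restricted to a facet, in the relative interior
  of that facet, but it may jump at the relative boundaries. Measurability is therefore established
  up to null sets, using that the surface measure is complete and that the lower dimensional faces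
  are null for it; boundedness on the cube then gives the integrability that additivity and
  monotonicity of the integral require.

  The second is dimension: facets carry an (n - 1)-dimensional measure, while every coordinate
  vector lives in \<open>real ^ 'n\<close>. The reference measure on the hyperplane
  \<open>t $ i = 0\<close> is Lebesgue measure of the slab \<open>0 < t $ i < 1\<close> projected
  along direction i. The slab has thickness 1, so an integral over a facet becomes an integral over
  the whole open cube of a function with its i-th coordinate frozen. Volume and facet integrals then
  share one domain, where the comparison is pointwise.\<close>

lemma hausdorff_content_antimono:
  assumes "\<delta> \<le> \<delta>'"
  shows "hausdorff_content d \<delta>' A \<le> hausdorff_content d \<delta> A"
  unfolding hausdorff_content_def hausdorff_covers_def
  using assms by (intro INF_superset_mono) (auto intro: order_trans)

lemma hausdorff_outer_mono: "A \<subseteq> B \<Longrightarrow> hausdorff_outer d A \<le> hausdorff_outer d B"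
  using outer_measure_space_hausdorff_outer[of d]
  by (auto simp: outer_measure_space_def increasing_def)

lemma hausdorff_outer_empty [simp]: "hausdorff_outer d {} = 0"
  using outer_measure_space_hausdorff_outer[of d]
  by (auto simp: outer_measure_space_def positive_def)

text \<open>\<open>countably_subadditive\<close> speaks of disjoint families; overlapping sets are
  shrunk by \<open>disjointed\<close> first.\<close>

lemma hausdorff_outer_countable_Un:
  fixes A :: "nat \<Rightarrow> 'a::metric_space set"
  shows "hausdorff_outer d (\<Union>i. A i) \<le> (\<Sum>i. hausdorff_outer d (A i))"
proof -
  have "hausdorff_outer d (\<Union>i. disjointed A i) \<le> (\<Sum>i. hausdorff_outer d (disjointed A i))"
    using outer_measure_space_hausdorff_outer[of d, where 'a='a] disjoint_family_disjointed[of A]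
    by (auto simp: outer_measure_space_def countably_subadditive_def)
  also have "\<dots> \<le> (\<Sum>i. hausdorff_outer d (A i))"
    by (intro suminf_le hausdorff_outer_mono disjointed_subset) auto
  finally show ?thesis by (simp add: UN_disjointed_eq)
qed

lemma hausdorff_outer_Un:
  "hausdorff_outer d (A \<union> B) \<le> hausdorff_outer d A + hausdorff_outer d B"
  for A B :: "'a::metric_space set"
proof -
  have "(\<Union>i. (\<lambda>i::nat. if i = 0 then A else if i = 1 then B else {}) i) = A \<union> B"
    by (auto split: if_splits)
  moreover have "(\<Sum>i::nat. hausdorff_outer d (if i = 0 then A else if i = 1 then B else {}))
      = (\<Sum>i\<in>{0,1::nat}. hausdorff_outer d (if i = 0 then A else if i = 1 then B else {}))"
    by (rule suminf_finite) auto
  ultimately show ?thesis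
    using hausdorff_outer_countable_Un[of d "\<lambda>i::nat. if i = 0 then A else if i = 1 then B else {}"]
    by simp
qed

text \<open>The metric outer measure property: a set of diameter below \<open>r\<close> cannot meet
  both \<open>A\<close> and \<open>B\<close>, so every fine cover of the union splits into a cover
  of each part at no extra cost.\<close>

lemma hausdorff_outer_separated:
  assumes r: "r > 0" and sep: "\<And>a b. a \<in> A \<Longrightarrow> b \<in> B \<Longrightarrow> r \<le> dist a b"
  shows "hausdorff_outer d (A \<union> B) = hausdorff_outer d A + hausdorff_outer d B"
proof (rule antisym[OF hausdorff_outer_Un])
  have content: "hausdorff_content d \<delta> A + hausdorff_content d \<delta> B \<le> hausdorff_outer d (A \<union> B)"
    if \<delta>: "0 < \<delta>" "\<delta> < r" for \<delta>
  proof -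
    have "hausdorff_content d \<delta> A + hausdorff_content d \<delta> B \<le> (\<Sum>i. hausdorff_gauge d (C i))"
      if C: "C \<in> hausdorff_covers \<delta> (A \<union> B)" for C
    proof -
      \<comment> \<open>Members meeting \<open>A\<close> go to \<open>CA\<close>, all others to
        \<open>CB\<close>. The vacated places hold the empty set, whose gauge is 0 even for d = 0,
        so the two sums add up to the original one.\<close>
      define CA where "CA = (\<lambda>i. if C i \<inter> A = {} then {} else C i)"
      define CB where "CB = (\<lambda>i. if C i \<inter> A = {} then C i else {})"
      have disj: "b \<notin> C i" if "a \<in> C i" "a \<in> A" "b \<in> B" for a b i
      proof
        assume "b \<in> C i"
        then have "dist a b \<le> diameter (C i)"
          using C that by (intro diameter_bounded_bound) (auto simp: hausdorff_covers_def)
        then show False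
          using C sep[OF that(2,3)] \<delta> by (auto simp: hausdorff_covers_def dest: spec[of _ i])
      qed
      have cov: "x \<in> A \<union> B \<Longrightarrow> \<exists>i. x \<in> C i"
        and bd: "\<And>i. bounded (C i)" "\<And>i. diameter (C i) \<le> \<delta>" for x
        using C by (auto simp: hausdorff_covers_def)
      have "A \<subseteq> (\<Union>i. CA i)"
        using cov by (force simp: CA_def)
      moreover have "B \<subseteq> (\<Union>i. CB i)"
      proof
        fix b assume b: "b \<in> B"
        then obtain i where i: "b \<in> C i" using cov by blast
        then have "C i \<inter> A = {}" using disj b by blast
        then show "b \<in> (\<Union>i. CB i)" using i by (auto simp: CB_def)
      qed
      ultimately have "CA \<in> hausdorff_covers \<delta> A" "CB \<in> hausdorff_covers \<delta> B"
        using bd \<delta> by (auto simp: hausdorff_covers_def CA_def CB_def)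
      then have "hausdorff_content d \<delta> A + hausdorff_content d \<delta> B
          \<le> (\<Sum>i. hausdorff_gauge d (CA i)) + (\<Sum>i. hausdorff_gauge d (CB i))"
        unfolding hausdorff_content_def by (intro add_mono INF_lower)
      also have "\<dots> = (\<Sum>i. hausdorff_gauge d (CA i) + hausdorff_gauge d (CB i))"
        by (rule suminf_add) auto
      also have "\<dots> = (\<Sum>i. hausdorff_gauge d (C i))"
        by (intro suminf_cong) (auto simp: CA_def CB_def hausdorff_gauge_def)
      finally show ?thesis .
    qed
    then have "hausdorff_content d \<delta> A + hausdorff_content d \<delta> B \<le> hausdorff_content d \<delta> (A \<union> B)"
      unfolding hausdorff_content_def[of d \<delta> "A \<union> B"] by (rule INF_greatest)
    also have "\<dots> \<le> hausdorff_outer d (A \<union> B)"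
      unfolding hausdorff_outer_def using \<delta> by (intro SUP_upper) auto
    finally show ?thesis .
  qed
  \<comment> \<open>The contents grow as \<delta> decreases, so two scales are dominated by their
    minimum and the suprema can be merged into one.\<close>
  have "hausdorff_outer d A + hausdorff_outer d B =
      (SUP \<delta>\<in>{0<..}. hausdorff_content d \<delta> A + hausdorff_content d \<delta> B)"
    unfolding hausdorff_outer_def
  proof (rule SUP_add_directed_ennreal[symmetric])
    fix x y :: real assume xy: "x \<in> {0<..}" "y \<in> {0<..}"
    then show "\<exists>k\<in>{0<..}. hausdorff_content d x A + hausdorff_content d y B
        \<le> hausdorff_content d k A + hausdorff_content d k B"
      by (intro bexI[of _ "min x y"] add_mono hausdorff_content_antimono) auto
  qed
  also have "\<dots> \<le> hausdorff_outer d (A \<union> B)"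
  proof (rule SUP_least)
    fix \<delta> :: real assume "\<delta> \<in> {0<..}"
    then have "hausdorff_content d \<delta> A + hausdorff_content d \<delta> B
        \<le> hausdorff_content d (min \<delta> (r/2)) A + hausdorff_content d (min \<delta> (r/2)) B"
      by (intro add_mono hausdorff_content_antimono) auto
    also have "\<dots> \<le> hausdorff_outer d (A \<union> B)"
      using \<open>\<delta> \<in> {0<..}\<close> r by (intro content) auto
    finally show "hausdorff_content d \<delta> A + hausdorff_content d \<delta> B \<le> hausdorff_outer d (A \<union> B)" .
  qed
  finally show "hausdorff_outer d A + hausdorff_outer d B \<le> hausdorff_outer d (A \<union> B)" .
qed

lemma ennreal_suminf_tail:
  fixes f :: "nat \<Rightarrow> ennreal"
  assumes fin: "(\<Sum>i. f i) < top" and e: "0 < e"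
  shows "\<exists>n. (\<Sum>i. f (i + n)) < ennreal e"
proof -
  have f: "f i < top" for i using ennreal_suminf_lessD[OF fin] .
  define r where "r i = enn2real (f i)" for i
  have fr: "f i = ennreal (r i)" for i using f[of i] by (simp add: r_def)
  have r: "0 \<le> r i" for i by (simp add: r_def)
  have s: "summable r"
    using fin r by (intro summable_suminf_not_top) (auto simp: fr less_top)
  from suminf_exist_split[OF e s] obtain n where n: "norm (\<Sum>i. r (i + n)) < e" by auto
  have "(\<Sum>i. f (i + n)) = ennreal (\<Sum>i. r (i + n))"
    using summable_ignore_initial_segment[OF s] r unfolding fr by (intro suminf_ennreal2) auto
  also have "\<dots> < ennreal e" using n e by (intro ennreal_lessI) auto
  finally show ?thesis ..
qed

text \<open>
  Caratheodory's criterion: \<open>E - A\<close> is exhausted by the sets \<open>D n\<close> of points of \<open>E\<close> at distance at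
  least \<open>1 / (n + 1)\<close> from \<open>A\<close>. The shells \<open>R k = D (k + 1) - D k\<close> have finite total measure because
  \<open>R (n + 1)\<close> has positive distance from \<open>D n\<close>, so that the sum telescopes.
\<close>

lemma closed_in_lambda_system_hausdorff_outer:
  fixes A :: "'a::metric_space set"
  assumes "closed A"
  shows "A \<in> lambda_system UNIV UNIV (hausdorff_outer d)"
\<comment> \<open>The distance to the empty set is 0 by convention, so the sets \<open>D n\<close>
  below would not exhaust \<open>E\<close>.\<close>
proof (cases "A = {}")
  case True then show ?thesis by (simp add: lambda_system_def)
next
  case False
  let ?m = "hausdorff_outer d"
  have main: "?m (E \<inter> A) + ?m (E - A) \<le> ?m E" if E: "?m E < top" for E
  proof (rule ennreal_le_epsilon)
    fix e :: real assume e: "0 < e"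
    define D where "D n = E \<inter> {x. 1 / (real n + 1) \<le> infdist x A}" for n :: nat
    define R where "R k = D (Suc k) - D k" for k
    have D_mono: "D n \<subseteq> D (Suc n)" for n
    proof -
      have "1 / (real (Suc n) + 1) \<le> 1 / (real n + 1)" by (simp add: field_simps)
      then show ?thesis unfolding D_def using order_trans by blast
    qed
    have D_sub: "D n \<subseteq> E" for n by (auto simp: D_def)
    have sep: "?m (D n \<union> R (Suc n)) = ?m (D n) + ?m (R (Suc n))" for n
    proof (rule hausdorff_outer_separated)
      show "0 < 1 / (real n + 1) - 1 / (real (Suc n) + 1)" by (simp add: frac_less2)
      fix a b assume "a \<in> D n" "b \<in> R (Suc n)"
      then have "1 / (real n + 1) \<le> infdist a A" "infdist b A < 1 / (real (Suc n) + 1)"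
        by (auto simp: D_def R_def)
      moreover have "infdist a A \<le> infdist b A + dist a b" by (rule infdist_triangle)
      ultimately show "1 / (real n + 1) - 1 / (real (Suc n) + 1) \<le> dist a b" by linarith
    qed
    \<comment> \<open>Separation skips one shell, so the sum telescopes only in steps of two.
      Carrying two consecutive \<open>D\<close> in the bound lets a single induction handle even and
      odd shells; the common term \<open>?m (D n)\<close> is finite and cancels.\<close>
    have tel: "(\<Sum>k<n. ?m (R (Suc k))) \<le> ?m (D n) + ?m (D (Suc n))" for n
    proof (induction n)
      case (Suc n)
      have "D n \<union> R (Suc n) \<subseteq> D (Suc (Suc n))"
        using D_mono by (auto simp: R_def)
      then have "?m (D n) + ?m (R (Suc n)) \<le> ?m (D (Suc (Suc n)))"
        unfolding sep[symmetric] by (rule hausdorff_outer_mono)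
      with Suc have "(\<Sum>k<n. ?m (R (Suc k))) + (?m (D n) + ?m (R (Suc n)))
          \<le> (?m (D n) + ?m (D (Suc n))) + ?m (D (Suc (Suc n)))"
        by (rule add_mono)
      then have "?m (D n) + ((\<Sum>k<n. ?m (R (Suc k))) + ?m (R (Suc n)))
          \<le> ?m (D n) + (?m (D (Suc n)) + ?m (D (Suc (Suc n))))"
        by (simp add: ac_simps)
      moreover have "?m (D n) \<noteq> top"
        using hausdorff_outer_mono[OF D_sub, of d n] E by (auto simp: top_unique)
      ultimately show ?case by (simp add: ennreal_add_left_cancel_le)
    qed simp
    have "(\<Sum>k. ?m (R (Suc k))) \<le> ?m E + ?m E"
    proof (rule suminf_le_const)
      show "summable (\<lambda>k. ?m (R (Suc k)))" by simp
      fix n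
      show "(\<Sum>k<n. ?m (R (Suc k))) \<le> ?m E + ?m E"
        by (rule order_trans[OF tel]) (intro add_mono hausdorff_outer_mono D_sub)
    qed
    also have "\<dots> < top" using E by simp
    finally have "(\<Sum>k. ?m (R (Suc k))) < top" .
    from ennreal_suminf_tail[OF this e] obtain n
      where n: "(\<Sum>i. ?m (R (Suc (i + n)))) < ennreal e" by auto
    have "E - A \<subseteq> D (Suc n) \<union> (\<Union>i. R (Suc (i + n)))"
    proof
      fix x assume x: "x \<in> E - A"
      then have "infdist x A > 0"
        using assms False by (simp add: infdist_pos_not_in_closed)
      then obtain k where k: "1 / (real k + 1) < infdist x A"
        using reals_Archimedean[of "infdist x A"] by (auto simp: inverse_eq_divide add.commute)
      then have ex: "x \<in> D k" using x by (auto simp: D_def)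
      define l where "l = (LEAST k. x \<in> D k)"
      have l: "x \<in> D l" unfolding l_def by (rule LeastI, rule ex)
      have l': "x \<notin> D j" if "j < l" for j using that not_less_Least l_def by blast
      have Dle: "D i \<subseteq> D j" if "i \<le> j" for i j using lift_Suc_mono_le[of D, OF D_mono that] .
      show "x \<in> D (Suc n) \<union> (\<Union>i. R (Suc (i + n)))"
      proof (cases "l \<le> Suc n")
        case True then show ?thesis using Dle l by blast
      next
        case f: False
        then obtain i where i: "l = Suc (Suc (i + n))"
          by (metis Suc_le_lessD add.commute less_iff_Suc_add not_less_eq_eq add_Suc)
        then have "x \<in> R (Suc (i + n))" using l l' by (auto simp: R_def)
        then show ?thesis by blast
      qed
    qed
    then have "?m (E - A) \<le> ?m (D (Suc n) \<union> (\<Union>i. R (Suc (i + n))))"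
      by (rule hausdorff_outer_mono)
    also have "\<dots> \<le> ?m (D (Suc n)) + ?m (\<Union>i. R (Suc (i + n)))"
      by (rule hausdorff_outer_Un)
    also have "\<dots> \<le> ?m (D (Suc n)) + ennreal e"
      by (rule add_left_mono, rule order_trans[OF hausdorff_outer_countable_Un less_imp_le[OF n]])
    finally have "?m (E \<inter> A) + ?m (E - A) \<le> ?m (E \<inter> A) + ?m (D (Suc n)) + ennreal e"
      by (simp add: add.assoc add_left_mono)
    also have "?m (E \<inter> A) + ?m (D (Suc n)) = ?m ((E \<inter> A) \<union> D (Suc n))"
    proof (rule hausdorff_outer_separated[symmetric])
      show "0 < 1 / (real (Suc n) + 1)" by simp
      fix a b assume "a \<in> E \<inter> A" "b \<in> D (Suc n)"
      then show "1 / (real (Suc n) + 1) \<le> dist a b"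
        using infdist_le[of a A b] by (auto simp: D_def dist_commute intro: order_trans)
    qed
    also have "\<dots> \<le> ?m E" by (rule hausdorff_outer_mono) (use D_sub in auto)
    finally show "?m (E \<inter> A) + ?m (E - A) \<le> ?m E + ennreal e" by (simp add: add_right_mono)
  qed
  have "?m (E \<inter> A) + ?m (E - A) = ?m E" for E
  proof (rule antisym)
    show "?m (E \<inter> A) + ?m (E - A) \<le> ?m E"
      using main[of E] by (cases "?m E < top") (auto simp: top.not_eq_extremum[symmetric])
    have "E = (E \<inter> A) \<union> (E - A)" by auto
    then show "?m E \<le> ?m (E \<inter> A) + ?m (E - A)"
      using hausdorff_outer_Un[of d "E \<inter> A" "E - A"] by simp
  qed
  then show ?thesis by (auto simp: lambda_system_def Int_commute Diff_eq)
qed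

lemma sets_borel_subset_hausdorff:
  "sets (borel :: 'a::metric_space measure) \<subseteq> sets (hausdorff_measure d)"
proof -
  have "sets (borel :: 'a measure) = sigma_sets UNIV (Collect closed)"
    by (simp add: borel_eq_closed)
  also have "\<dots> \<subseteq> sets (hausdorff_measure d)"
    using sets.sigma_sets_subset[of "Collect closed" "hausdorff_measure d"]
      closed_in_lambda_system_hausdorff_outer[of _ d]
    by (auto simp: sets_hausdorff_measure)
  finally show ?thesis .
qed

lemma measurable_hausdorff_borel:
  "f \<in> borel_measurable borel \<Longrightarrow> f \<in> borel_measurable (hausdorff_measure d)"
  using sets_borel_subset_hausdorff[of d]
  by (auto simp: measurable_def)

section \<open>Null sets and completeness of the Hausdorff measure\<close>

lemma null_hausdorff:
  assumes "hausdorff_outer d N = 0"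
  shows "N \<in> null_sets (hausdorff_measure d)"
proof -
  have "hausdorff_outer d (N \<inter> x) + hausdorff_outer d ((UNIV - N) \<inter> x) = hausdorff_outer d x" for x
  proof (rule antisym)
    have "hausdorff_outer d (N \<inter> x) = 0"
      using hausdorff_outer_mono[of "N \<inter> x" N d] assms by auto
    then show "hausdorff_outer d (N \<inter> x) + hausdorff_outer d ((UNIV - N) \<inter> x) \<le> hausdorff_outer d x"
      by (simp add: hausdorff_outer_mono)
    have "x = (N \<inter> x) \<union> ((UNIV - N) \<inter> x)" by auto
    then show "hausdorff_outer d x \<le> hausdorff_outer d (N \<inter> x) + hausdorff_outer d ((UNIV - N) \<inter> x)"
      using hausdorff_outer_Un[of d "N \<inter> x" "(UNIV - N) \<inter> x"] by simp
  qed
  then have "N \<in> sets (hausdorff_measure d)"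
    by (simp add: sets_hausdorff_measure lambda_system_def)
  then show ?thesis using assms by (simp add: null_sets_def emeasure_hausdorff_measure)
qed

text \<open>Makes the values of a function on the relative boundary of a facet irrelevant for
  measurability.\<close>

lemma complete_measure_hausdorff: "complete_measure (hausdorff_measure d)"
proof
  fix A B :: "'a set" assume "B \<subseteq> A" "A \<in> null_sets (hausdorff_measure d)"
  then have "hausdorff_outer d B = 0"
    using hausdorff_outer_mono[of B A d]
    by (auto simp: null_sets_def emeasure_hausdorff_measure)
  then show "B \<in> sets (hausdorff_measure d)" using null_hausdorff by blast
qed

section \<open>Isometry and translation invariance\<close>

lemma diameter_isometry:
  assumes "\<And>x y. dist (f x) (f y) = dist x y"
  shows "diameter (f ` S) = diameter S"
proof -
  have "(\<lambda>(x, y). dist x y) ` (f ` S \<times> f ` S) = (\<lambda>(x, y). dist x y) ` (S \<times> S)"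
    using assms by (force simp: image_iff)
  then show ?thesis by (simp add: diameter_def)
qed

text \<open>An isometry carries covers to covers with the same diameters. For an invertible isometry
  equality follows by applying this to the inverse as well.\<close>

lemma hausdorff_outer_isometry_le:
  fixes f :: "'a::metric_space \<Rightarrow> 'b::metric_space"
  assumes iso: "\<And>x y. dist (f x) (f y) = dist x y"
  shows "hausdorff_outer d (f ` A) \<le> hausdorff_outer d A"
  unfolding hausdorff_outer_def
proof (rule SUP_mono', goal_cases)
  case (1 \<delta>)
  show ?case unfolding hausdorff_content_def[of _ _ A]
  proof (rule INF_greatest)
    fix C assume C: "C \<in> hausdorff_covers \<delta> A"
    have bdd: "bounded (f ` C i)" for i
    proof -
      have "bounded (C i)" using C by (simp add: hausdorff_covers_def)
      then obtain x e where "\<And>y. y \<in> C i \<Longrightarrow> dist x y \<le> e" by (auto simp: bounded_def)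
      then show ?thesis unfolding bounded_def by (intro exI[of _ "f x"] exI[of _ e]) (simp add: iso)
    qed
    have "hausdorff_content d \<delta> (f ` A) \<le> (\<Sum>i. hausdorff_gauge d (f ` C i))"
      unfolding hausdorff_content_def
      using C bdd diameter_isometry[of f, OF iso]
      by (intro INF_lower) (simp add: hausdorff_covers_def image_UN[symmetric] image_mono)
    also have "\<dots> = (\<Sum>i. hausdorff_gauge d (C i))"
      unfolding hausdorff_gauge_def by (subst diameter_isometry[OF iso]) simp
    finally show "hausdorff_content d \<delta> (f ` A) \<le> (\<Sum>i. hausdorff_gauge d (C i))" .
  qed
qed

lemma hausdorff_outer_translation:
  fixes A :: "'a::real_normed_vector set"
  shows "hausdorff_outer d ((+) v ` A) = hausdorff_outer d A"
proof (rule antisym)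
  show "hausdorff_outer d ((+) v ` A) \<le> hausdorff_outer d A"
    by (rule hausdorff_outer_isometry_le) simp
  have "hausdorff_outer d ((+) (- v) ` ((+) v ` A)) \<le> hausdorff_outer d ((+) v ` A)"
    by (rule hausdorff_outer_isometry_le) (rule dist_add_cancel)
  then show "hausdorff_outer d A \<le> hausdorff_outer d ((+) v ` A)"
    by (simp add: image_image)
qed

section \<open>Translation invariant measures on coordinate subspaces\<close>

text \<open>Cauchy's functional equation. Since the values are nonnegative, additivity already
  forces monotonicity, and monotone additive functions are linear.\<close>

lemma additive_ennreal_linear:
  fixes g :: "real \<Rightarrow> ennreal"
  assumes add: "\<And>x y. 0 \<le> x \<Longrightarrow> 0 \<le> y \<Longrightarrow> g (x + y) = g x + g y"
    and fin: "g 1 < top" and x: "0 \<le> x"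
  shows "g x = ennreal x * g 1"
proof -
  have mono: "g x \<le> g y" if "0 \<le> x" "x \<le> y" for x y
    using add[of x "y - x"] that by simp
  have "g 1 = g 1 + g 0" using add[of 1 0] by simp
  then have g0: "g 0 = 0" using fin
    by (metis add.right_neutral ennreal_add_left_cancel less_irrefl infinity_ennreal_def)
  have mult: "g (real n * x) = of_nat n * g x" if "0 \<le> x" for n x
  proof (induction n)
    case (Suc n)
    have "g (real (Suc n) * x) = g (real n * x + x)" by (simp add: algebra_simps)
    also have "\<dots> = g (real n * x) + g x" using that by (intro add) auto
    finally show ?case using Suc by (simp add: algebra_simps)
  qed (simp add: g0)
  have fin': "g x < top" if "0 \<le> x" for x
  proof -
    obtain n where "x \<le> real n" using real_arch_simple by blast
    then have "g x \<le> g (real n * 1)" using that by (intro mono) auto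
    also have "\<dots> < top" using fin by (subst mult) (auto simp: ennreal_mult_less_top of_nat_less_top)
    finally show ?thesis .
  qed
  define f where "f x = enn2real (g x)" for x
  have fg: "g x = ennreal (f x)" if "0 \<le> x" for x using fin'[OF that] by (simp add: f_def)
  have f_nonneg: "0 \<le> f x" for x by (simp add: f_def)
  have f_mono: "f x \<le> f y" if "0 \<le> x" "x \<le> y" for x y
    unfolding f_def using that mono fin' by (intro enn2real_mono) auto
  have f_mult: "f (real n * x) = real n * f x" if "0 \<le> x" for n x
    using mult[OF that, of n] by (simp add: f_def enn2real_mult ennreal_of_nat_eq_real_of_nat)
  \<comment> \<open>Both \<open>real n * f x\<close> and \<open>real n * x * f 1\<close> lie between
    \<open>k * f 1\<close> and \<open>(k + 1) * f 1\<close>, where \<open>k\<close> is the integer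
    part of \<open>real n * x\<close>. The resulting bound \<open>f 1\<close> is independent of
    \<open>n\<close>, which forces the difference to vanish.\<close>
  have bound: "real n * \<bar>f x - x * f 1\<bar> \<le> f 1" for n
  proof -
    define k where "k = nat \<lfloor>real n * x\<rfloor>"
    have k: "real k \<le> real n * x" "real n * x \<le> real (Suc k)"
      using x by (auto simp: k_def) linarith+
    have "real k * f 1 \<le> real n * f x" "real n * f x \<le> real (Suc k) * f 1"
      using f_mono[OF _ k(1)] f_mono[OF _ k(2)] f_mult[of 1] f_mult[OF x] x by (auto simp del: of_nat_Suc)
    moreover have "real k * f 1 \<le> real n * x * f 1" "real n * x * f 1 \<le> real (Suc k) * f 1"
      using k f_nonneg by (auto intro!: mult_right_mono simp del: of_nat_Suc)
    ultimately have "\<bar>real n * f x - real n * x * f 1\<bar> \<le> f 1"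
      by (simp add: algebra_simps abs_le_iff)
    moreover have "real n * \<bar>f x - x * f 1\<bar> = \<bar>real n * f x - real n * x * f 1\<bar>"
      by (metis abs_mult abs_of_nat mult.assoc right_diff_distrib)
    ultimately show ?thesis by simp
  qed
  have "f x = x * f 1"
  proof (rule ccontr)
    assume "f x \<noteq> x * f 1"
    then have "0 < \<bar>f x - x * f 1\<bar>" by simp
    then obtain n where "f 1 < real n * \<bar>f x - x * f 1\<bar>" using reals_Archimedean3 by blast
    then show False using bound[of n] by simp
  qed
  then show ?thesis using fg[OF x] fg[of 1] x by (simp add: ennreal_mult f_nonneg)
qed

text \<open>Half-open sides let a box be cut into disjoint boxes of the same kind and keep the
  full-dimensional family closed under intersection. Coordinates outside \<open>J\<close> are left
  free: the measures compared live where these coordinates vanish.\<close>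

definition hbox :: "'n set \<Rightarrow> real ^ 'n \<Rightarrow> real ^ 'n \<Rightarrow> (real ^ 'n) set" where
  "hbox J l r = {t. \<forall>j\<in>J. l $ j \<le> t $ j \<and> t $ j < r $ j}"

lemma hbox_borel [measurable]: "hbox J l r \<in> sets borel"
  for l r :: "real ^ 'n::finite"
proof -
  have "hbox J l r = (\<Inter>j\<in>J. {t. l $ j \<le> t $ j} \<inter> {t. t $ j < r $ j}) \<inter> UNIV"
    by (auto simp: hbox_def)
  also have "\<dots> \<in> sets borel"
    by (cases "J = {}") (auto intro!: sets.finite_INT)
  finally show ?thesis .
qed

lemma sets_borel_hbox:
  "sets (borel :: (real ^ 'n::finite) measure) = sigma_sets UNIV (range (\<lambda>(l, r). hbox UNIV l r))"
proof (rule antisym)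
  let ?S = "sigma_sets UNIV (range (\<lambda>(l, r). hbox UNIV l r :: (real ^ 'n) set))"
  have box: "box l r \<in> ?S" for l r :: "real ^ 'n"
  proof -
    have "box l r = (\<Union>n. hbox UNIV (\<chi> j. l $ j + inverse (real (Suc n))) r)"
    proof (intro set_eqI iffI)
      fix t assume t: "t \<in> box l r"
      define e where "e = Min (range (\<lambda>j. t $ j - l $ j))"
      have "0 < e" using t by (auto simp: e_def mem_box_cart)
      then obtain n where n: "inverse (real (Suc n)) < e" using reals_Archimedean by blast
      have "e \<le> t $ j - l $ j" for j by (auto simp: e_def)
      then have "l $ j + inverse (real (Suc n)) \<le> t $ j" for j using n by (smt (verit))
      then show "t \<in> (\<Union>n. hbox UNIV (\<chi> j. l $ j + inverse (real (Suc n))) r)"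
        using t by (auto simp: hbox_def mem_box_cart)
    next
      fix t assume "t \<in> (\<Union>n. hbox UNIV (\<chi> j. l $ j + inverse (real (Suc n))) r)"
      then obtain n where n: "l $ j + inverse (real (Suc n)) \<le> t $ j" "t $ j < r $ j" for j
        by (auto simp: hbox_def)
      have "0 < inverse (real (Suc n))" by simp
      then have "l $ j < t $ j" for j using n(1)[of j] by linarith
      then show "t \<in> box l r" using n by (auto simp: mem_box_cart)
    qed
    also have "\<dots> \<in> ?S" by (intro sigma_sets.Union sigma_sets.Basic) auto
    finally show ?thesis .
  qed
  have "sets (borel :: (real ^ 'n) measure) = sigma_sets UNIV (range (\<lambda>(a, b). box a b))"
    by (simp add: borel_eq_box)
  also have "\<dots> \<subseteq> ?S" by (intro sigma_sets_mono) (auto intro: box)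
  finally show "sets (borel :: (real ^ 'n) measure) \<subseteq> ?S" .
  show "?S \<subseteq> sets borel"
    using sets.sigma_sets_subset[of "range (\<lambda>(l, r). hbox UNIV l r :: (real ^ 'n) set)" borel] by force
qed

text \<open>
  The measure is an additive function of each side length, since a box splits into a box and a
  translate of a box.
\<close>

lemma emeasure_hbox:
  fixes M :: "(real ^ 'n::finite) measure"
  assumes M: "sets M = sets borel"
    and inv: "\<And>v B. (\<And>j. j \<notin> J \<Longrightarrow> v $ j = 0) \<Longrightarrow> B \<in> sets borel \<Longrightarrow> emeasure M ((+) v ` B) = emeasure M B"
    and fin: "emeasure M (hbox J 0 1) < top"
    and lr: "\<And>j. j \<in> J \<Longrightarrow> l $ j \<le> r $ j"
  shows "emeasure M (hbox J l r) = ennreal (\<Prod>j\<in>J. r $ j - l $ j) * emeasure M (hbox J 0 1)"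
proof -
  let ?Z = "\<lambda>a. hbox J 0 (\<chi> j. a j)"
  \<comment> \<open>The sides are changed from 1 to \<open>a j\<close> one coordinate at a time:
    \<open>K\<close> holds the coordinates already treated, and \<open>b x\<close> below gives the
    next one the variable length \<open>x\<close>.\<close>
  have Z: "emeasure M (?Z (\<lambda>j. if j \<in> K then a j else 1)) = ennreal (\<Prod>j\<in>K. a j) * emeasure M (hbox J 0 1)"
    if K: "K \<subseteq> J" and a: "\<And>j. 0 \<le> a j" for K a
    using finite[of K] K
  proof induction
    case empty
    have "(\<chi> j. 1) = (1 :: real ^ 'n)" by (simp add: vec_eq_iff)
    then show ?case by simp
  next
    case (insert i K)
    define b where "b x j = (if j = i then x else if j \<in> K then a j else 1)" for x j
    define g where "g x = emeasure M (?Z (b x))" for x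
    have "g 1 = emeasure M (?Z (\<lambda>j. if j \<in> K then a j else 1))"
      unfolding g_def b_def using insert by (intro arg_cong[where f="\<lambda>a. emeasure M (?Z a)"]) auto
    then have g1: "g 1 = ennreal (\<Prod>j\<in>K. a j) * emeasure M (hbox J 0 1)" using insert by simp
    have "g (x + y) = g x + g y" if xy: "0 \<le> x" "0 \<le> y" for x y
    proof -
      have "?Z (b (x + y)) = ?Z (b x) \<union> (+) (axis i x) ` ?Z (b y)"
      proof (intro set_eqI iffI)
        fix t assume t: "t \<in> ?Z (b (x + y))"
        show "t \<in> ?Z (b x) \<union> (+) (axis i x) ` ?Z (b y)"
        proof (cases "t $ i < x")
          case True
          then show ?thesis using t by (auto simp: hbox_def b_def)
        next
          case False
          then have "t - axis i x \<in> ?Z (b y)"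
            using t insert by (auto simp: hbox_def b_def axis_def)
          moreover have "t = axis i x + (t - axis i x)" by simp
          ultimately show ?thesis by blast
        qed
      next
        fix t assume "t \<in> ?Z (b x) \<union> (+) (axis i x) ` ?Z (b y)"
        then show "t \<in> ?Z (b (x + y))"
          using xy insert by (fastforce simp: hbox_def b_def axis_def split: if_splits)
      qed
      moreover have "?Z (b x) \<inter> (+) (axis i x) ` ?Z (b y) = {}"
        using insert by (force simp: hbox_def b_def axis_def)
      moreover have shift: "(+) (axis i x) ` ?Z (b y) \<in> sets borel"
      proof -
        have "(+) (axis i x) ` ?Z (b y) = hbox J (axis i x) (axis i x + (\<chi> j. b y j))"
        proof (intro set_eqI iffI)
          fix t assume "t \<in> hbox J (axis i x) (axis i x + (\<chi> j. b y j))"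
          then have "t - axis i x \<in> ?Z (b y)" by (auto simp: hbox_def algebra_simps)
          moreover have "t = axis i x + (t - axis i x)" by simp
          ultimately show "t \<in> (+) (axis i x) ` ?Z (b y)" by blast
        qed (auto simp: hbox_def)
        then show ?thesis by simp
      qed
      ultimately have "g (x + y) = g x + emeasure M ((+) (axis i x) ` ?Z (b y))"
        unfolding g_def using M by (simp add: plus_emeasure)
      also have "emeasure M ((+) (axis i x) ` ?Z (b y)) = g y"
        unfolding g_def using insert by (intro inv) (auto simp: axis_def)
      finally show ?thesis .
    qed
    moreover have "g 1 < top" using g1 fin by (simp add: ennreal_mult_less_top)
    ultimately have "g (a i) = ennreal (a i) * g 1" using a by (rule additive_ennreal_linear)
    moreover have "b (a i) = (\<lambda>j. if j \<in> insert i K then a j else 1)" by (auto simp: b_def)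
    ultimately show ?case
      using insert g1 a by (simp add: g_def ennreal_mult prod_nonneg mult.assoc)
  qed
  define v where "v = (\<chi> j. if j \<in> J then l $ j else 0)"
  define a where "a j = (if j \<in> J then r $ j - l $ j else 1)" for j
  have "hbox J l r = (+) v ` ?Z a"
  proof (intro set_eqI iffI)
    fix t assume "t \<in> hbox J l r"
    then have "t - v \<in> ?Z a" by (auto simp: hbox_def v_def a_def)
    moreover have "t = v + (t - v)" by simp
    ultimately show "t \<in> (+) v ` ?Z a" by blast
  qed (auto simp: hbox_def v_def a_def)
  then have "emeasure M (hbox J l r) = emeasure M (?Z a)"
    by (simp add: inv v_def)
  also have "?Z a = ?Z (\<lambda>j. if j \<in> J then a j else 1)" by (simp add: a_def hbox_def)
  also have "emeasure M \<dots> = ennreal (\<Prod>j\<in>J. a j) * emeasure M (hbox J 0 1)"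
    using lr by (intro Z) (auto simp: a_def)
  finally show ?thesis by (simp add: a_def cong: prod.cong)
qed

text \<open>
  Lower dimensional Euclidean space is encoded as the coordinate subspace \<open>{t. \<forall>j. j \<notin> J \<longrightarrow> t $ j = 0}\<close>
  of \<open>real ^ 'n\<close>, because there is no index type of cardinality \<open>n - 1\<close>.
\<close>

lemma translation_invariant_unique:
  fixes M N :: "(real ^ 'n::finite) measure"
  assumes M: "sets M = sets borel"
    and M_inv: "\<And>v B. (\<And>j. j \<notin> J \<Longrightarrow> v $ j = 0) \<Longrightarrow> B \<in> sets borel \<Longrightarrow> emeasure M ((+) v ` B) = emeasure M B"
    and M_conc: "\<And>j. j \<notin> J \<Longrightarrow> emeasure M {t. t $ j \<noteq> 0} = 0"
    and M_fin: "emeasure M (hbox J 0 1) < top"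
    and N: "sets N = sets borel"
    and N_inv: "\<And>v B. (\<And>j. j \<notin> J \<Longrightarrow> v $ j = 0) \<Longrightarrow> B \<in> sets borel \<Longrightarrow> emeasure N ((+) v ` B) = emeasure N B"
    and N_conc: "\<And>j. j \<notin> J \<Longrightarrow> emeasure N {t. t $ j \<noteq> 0} = 0"
    and N_1: "emeasure N (hbox J 0 1) = 1"
  shows "M = density N (\<lambda>_. emeasure M (hbox J 0 1))"
proof -
  let ?c = "emeasure M (hbox J 0 1)" and ?E = "range (\<lambda>(l, r). hbox UNIV l r :: (real ^ 'n) set)"
  \<comment> \<open>Almost everywhere the coordinates outside \<open>J\<close> are 0, so a
    constraint on such a coordinate either holds almost everywhere or fails almost everywhere,
    depending on whether its interval contains 0.\<close>
  have drop: "emeasure L (hbox UNIV l r) =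
      (if \<forall>j. j \<notin> J \<longrightarrow> l $ j \<le> 0 \<and> 0 < r $ j then emeasure L (hbox J l r) else 0)"
    if L: "sets L = sets borel" "\<And>j. j \<notin> J \<Longrightarrow> emeasure L {t. t $ j \<noteq> 0} = 0"
    for L l r
  proof -
    have null: "{t. t $ j \<noteq> 0} \<in> null_sets L" if "j \<notin> J" for j
      using L that by (auto simp: null_sets_def)
    show ?thesis
    proof (cases "\<forall>j. j \<notin> J \<longrightarrow> l $ j \<le> 0 \<and> 0 < r $ j")
      case True
      have "(\<Union>j\<in>-J. {t. t $ j \<noteq> 0}) \<in> null_sets L"
        using null by (intro null_sets.finite_UN) auto
      then have ae: "AE t in L. t \<notin> (\<Union>j\<in>-J. {t. t $ j \<noteq> 0})" by (rule AE_not_in)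
      have "emeasure L (hbox UNIV l r) = emeasure L (hbox J l r)"
      proof (rule emeasure_eq_AE)
        show "AE t in L. (t \<in> hbox UNIV l r) = (t \<in> hbox J l r)"
          using ae
        proof eventually_elim
          case (elim t)
          then have "t $ j = 0" if "j \<notin> J" for j using that by auto
          then show ?case using True by (fastforce simp: hbox_def)
        qed
      qed (simp_all add: L)
      then show ?thesis using True by simp
    next
      case False
      then obtain j where j: "j \<notin> J" "\<not> (l $ j \<le> 0 \<and> 0 < r $ j)" by auto
      then have "hbox UNIV l r \<subseteq> {t. t $ j \<noteq> 0}" by (auto simp: hbox_def dest!: spec[of _ j])
      then have "emeasure L (hbox UNIV l r) = 0"
        using null[OF j(1)] L by (auto intro!: emeasure_eq_0[where N="{t. t $ j \<noteq> 0}"] simp: null_sets_def)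
      then show ?thesis using j by auto
    qed
  qed
  have drop_M: "emeasure M (hbox UNIV l r) =
      (if \<forall>j. j \<notin> J \<longrightarrow> l $ j \<le> 0 \<and> 0 < r $ j then emeasure M (hbox J l r) else 0)" for l r
    by (rule drop[OF M]) (rule M_conc)
  have drop_N: "emeasure N (hbox UNIV l r) =
      (if \<forall>j. j \<notin> J \<longrightarrow> l $ j \<le> 0 \<and> 0 < r $ j then emeasure N (hbox J l r) else 0)" for l r
    by (rule drop[OF N]) (rule N_conc)
  have eq: "emeasure M X = emeasure (density N (\<lambda>_. ?c)) X" if "X \<in> ?E" for X
  proof -
    obtain l r where X: "X = hbox UNIV l r" using \<open>X \<in> ?E\<close> by auto
    have dens: "emeasure (density N (\<lambda>_. ?c)) X = ?c * emeasure N X"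
      using N by (simp add: X emeasure_density nn_integral_cmult_indicator)
    show ?thesis
    proof (cases "\<forall>j. l $ j \<le> r $ j")
      case True
      then have "emeasure M (hbox J l r) = ennreal (\<Prod>j\<in>J. r $ j - l $ j) * ?c"
        by (intro emeasure_hbox[OF M M_inv M_fin]) auto
      moreover have "emeasure N (hbox J 0 1) < top" using N_1 by simp
      then have "emeasure N (hbox J l r) = ennreal (\<Prod>j\<in>J. r $ j - l $ j) * emeasure N (hbox J 0 1)"
        using True by (intro emeasure_hbox[OF N N_inv]) auto
      ultimately have "emeasure M (hbox J l r) = ?c * emeasure N (hbox J l r)"
        by (simp add: N_1 mult.commute)
      then show ?thesis
        unfolding dens unfolding X drop_M drop_N by auto
    next
      case False
      then obtain j where "r $ j < l $ j" by (auto simp: not_le)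
      then have "X = {}" unfolding X hbox_def by (auto intro!: exI[of _ j])
      then show ?thesis by simp
    qed
  qed
  show ?thesis
  proof (rule measure_eqI_generator_eq[where E="?E" and \<Omega>=UNIV
        and A="\<lambda>n. hbox UNIV (\<chi> j. - real n) (\<chi> j. real n)"])
    show "Int_stable ?E"
      unfolding Int_stable_def
    proof (intro ballI)
      fix A B assume "A \<in> ?E" "B \<in> ?E"
      then obtain l r l' r' where "A = hbox UNIV l r" "B = hbox UNIV l' r'" by auto
      then have "A \<inter> B = hbox UNIV (\<chi> j. max (l $ j) (l' $ j)) (\<chi> j. min (r $ j) (r' $ j))"
        by (auto simp: hbox_def)
      then show "A \<inter> B \<in> ?E" by (simp add: range_eqI[where x="(_, _)"])
    qed
    show "sets M = sigma_sets UNIV ?E" using M sets_borel_hbox by simp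
    show "sets (density N (\<lambda>_. ?c)) = sigma_sets UNIV ?E" using N sets_borel_hbox by simp
    show "(\<Union>n. hbox UNIV (\<chi> j. - real n) (\<chi> j. real n)) = (UNIV :: (real ^ 'n) set)"
    proof (intro set_eqI iffI UNIV_I)
      fix t :: "real ^ 'n"
      obtain n where n: "norm t < real n" using reals_Archimedean2 by blast
      have "\<bar>t $ j\<bar> < real n" for j using component_le_norm_cart[of t j] n by linarith
      then have "t \<in> hbox UNIV (\<chi> j. - real n) (\<chi> j. real n)"
        by (auto simp: hbox_def abs_less_iff intro!: less_imp_le) (smt (verit))+
      then show "t \<in> (\<Union>n. hbox UNIV (\<chi> j. - real n) (\<chi> j. real n))" by blast
    qed
    fix n
    show "emeasure M (hbox UNIV (\<chi> j. - real n) (\<chi> j. real n)) \<noteq> \<infinity>"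
    proof -
      have "emeasure M (hbox J (\<chi> j. - real n) (\<chi> j. real n)) =
          ennreal (\<Prod>j\<in>J. (\<chi> j. real n) $ j - (\<chi> j. - real n) $ j) * ?c"
        by (intro emeasure_hbox[OF M M_inv M_fin]) auto
      also have "\<dots> < top" using M_fin by (intro ennreal_mult_less_top[THEN iffD2]) auto
      finally show ?thesis unfolding drop_M by auto
    qed
  qed (auto simp: eq)
qed

section \<open>Lebesgue measure under linear isomorphisms\<close>

abbreviation upd :: "'n::finite \<Rightarrow> real \<Rightarrow> real ^ 'n \<Rightarrow> real ^ 'n" where
  "upd i s t \<equiv> (\<chi> j. if j = i then s else t $ j)"

lemma continuous_upd: "continuous_on A (upd i s)"
proof (rule continuous_on_vec_lambda)
  show "continuous_on A (\<lambda>x. if j = i then s else x $ j)" for j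
    by (cases "j = i") (auto intro!: continuous_intros)
qed

lemma borel_measurable_upd [measurable]: "upd i s \<in> borel \<rightarrow>\<^sub>M borel"
  by (intro borel_measurable_continuous_onI continuous_upd)

lemma emeasure_lborel_cbox_cart:
  assumes "\<And>j. a $ j \<le> b $ j"
  shows "emeasure lborel (cbox a b) = ennreal (\<Prod>j\<in>UNIV. b $ j - a $ j)"
proof -
  have "a \<in> cbox a b" using assms by (simp add: mem_box_cart)
  then have "measure lborel (cbox a b) = (\<Prod>j\<in>UNIV. b $ j - a $ j)"
    by (intro content_cbox_cart) auto
  then show ?thesis by (metis emeasure_lborel_cbox_finite emeasure_eq_ennreal_measure infinity_ennreal_def less_irrefl)
qed

text \<open>Open and closed cube have equal measure. This serves boxes whose sides are partly open
  and partly half-open.\<close>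

lemma emeasure_lborel_unit_box:
  fixes B :: "(real ^ 'n::finite) set"
  assumes "B \<in> sets borel" "box 0 1 \<subseteq> B" "B \<subseteq> cbox 0 1"
  shows "emeasure lborel B = 1"
proof (rule antisym)
  have c: "emeasure lborel (cbox 0 (1 :: real ^ 'n)) = 1"
    by (subst emeasure_lborel_cbox_cart) auto
  then show "emeasure lborel B \<le> 1"
    using emeasure_mono[OF assms(3), of lborel] by simp
  have "emeasure lborel (box 0 (1 :: real ^ 'n)) = emeasure lborel (cbox 0 (1 :: real ^ 'n))"
    by (auto simp: emeasure_lborel_cbox_eq emeasure_lborel_box_eq)
  then show "1 \<le> emeasure lborel B"
    using emeasure_mono[OF assms(2), of lborel] assms(1) c by simp
qed

lemma borel_translation:
  fixes v :: "'a::real_normed_vector"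
  assumes "B \<in> sets borel"
  shows "(+) v ` B \<in> sets borel"
proof -
  have "(+) v ` B = (+) (- v) -` B"
    by (auto simp: image_iff intro!: bexI[of _ "- v + _"])
  moreover have "(+) (- v) \<in> borel \<rightarrow>\<^sub>M borel"
    by (intro borel_measurable_continuous_onI continuous_intros)
  ultimately show ?thesis using measurable_sets_borel[of "(+) (- v)" borel B] assms by simp
qed

lemma emeasure_lborel_translation:
  fixes v :: "'a::euclidean_space"
  assumes [measurable]: "B \<in> sets borel"
  shows "emeasure lborel ((+) v ` B) = emeasure lborel B"
proof -
  have "emeasure lborel B = emeasure (distr lborel borel ((+) (- v))) B"
    by (simp add: lborel_distr_plus)
  also have "\<dots> = emeasure lborel ((+) (- v) -` B)"
    by (subst emeasure_distr) auto
  also have "(+) (- v) -` B = (+) v ` B"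
    by (auto simp: image_iff intro!: bexI[of _ "- v + _"])
  finally show ?thesis by simp
qed

lemma null_sets_lborel_hyperplane: "{t :: real ^ 'n::finite. t $ j = a} \<in> null_sets lborel"
proof -
  have "{t :: real ^ 'n. t $ j = a} \<in> null_sets lebesgue"
    using negligible_standard_hyperplane[of "axis j 1 :: real ^ 'n" a]
    by (simp add: negligible_iff_null_sets cart_eq_inner_axis axis_in_Basis_iff)
  then show ?thesis by (simp add: null_sets_completion_iff)
qed

text \<open>Preimages under \<open>f\<close> and \<open>g\<close> differ only within
  \<open>N\<close>, all of whose subsets are measurable by completeness. Nothing is assumed about
  how \<open>f\<close> behaves on \<open>N\<close>.\<close>

lemma (in complete_measure) borel_measurable_cong_null:
  assumes g: "g \<in> measurable M L" and N: "N \<in> null_sets M"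
    and eq: "\<And>x. x \<in> space M - N \<Longrightarrow> f x = g x" and f: "f \<in> space M \<rightarrow> space L"
  shows "f \<in> measurable M L"
proof (rule measurableI)
  fix A assume A: "A \<in> sets L"
  have "f -` A \<inter> space M = (g -` A \<inter> space M - N) \<union> (f -` A \<inter> space M \<inter> N)"
    using eq by auto
  also have "\<dots> \<in> sets M"
    using measurable_sets[OF g A] N complete2[OF _ N, of "f -` A \<inter> space M \<inter> N"] by auto
  finally show "f -` A \<inter> space M \<in> sets M" .
qed (use f in auto)

text \<open>Carrying the inverse \<open>S\<close> along turns images under \<open>T\<close> into
  preimages under \<open>S\<close>, so images of Borel sets are Borel by continuity.\<close>

locale linear_iso =
  fixes T S :: "real ^ 'n::finite \<Rightarrow> real ^ 'n"
  assumes linear_T: "linear T" and linear_S: "linear S"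
    and TS [simp]: "T (S x) = x" and ST [simp]: "S (T x) = x"
begin

lemma cont: "continuous_on A T" "continuous_on A S"
  using linear_T linear_S by (auto intro: linear_continuous_on simp: linear_conv_bounded_linear)

lemma meas [measurable]: "T \<in> borel \<rightarrow>\<^sub>M borel" "S \<in> borel \<rightarrow>\<^sub>M borel"
  by (auto intro: borel_measurable_continuous_onI cont)

lemma image_T: "T ` B = S -` B"
  by (auto simp: image_iff) (metis TS)

lemma T_borel: "B \<in> sets borel \<Longrightarrow> T ` B \<in> sets borel"
  using measurable_sets[OF meas(2)] by (simp add: image_T)

lemma T_add: "T (x + y) = T x + T y" and S_diff: "S (x - y) = S x - S y"
  using linear_T linear_S by (auto simp: linear_add linear_diff)

lemma T_translate: "T ` ((+) v ` B) = (+) (T v) ` (T ` B)"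
  by (auto simp: T_add image_image)

text \<open>The push-forward is translation invariant, hence a multiple of Lebesgue measure by
  uniqueness with \<open>J = UNIV\<close>, where the concentration hypotheses are vacuous. The
  constant is the absolute determinant of \<open>T\<close>.\<close>

lemma lborel_distr_S:
  obtains c where "0 < c" "distr lborel borel S = density lborel (\<lambda>_. ennreal c)"
proof -
  let ?M = "distr lborel borel S"
  have M: "emeasure ?M B = emeasure lborel (T ` B)" if "B \<in> sets borel" for B
    using that by (simp add: emeasure_distr image_T)
  have bdd: "bounded (hbox UNIV 0 (1 :: real ^ 'n))"
    by (rule bounded_subset[OF bounded_cbox[of 0 1]])
      (auto simp: hbox_def mem_box_cart less_imp_le)
  have fin: "emeasure ?M (hbox UNIV 0 1) < top"
    using bounded_linear_image[OF bdd, of T] linear_T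
    by (simp add: M emeasure_bounded_finite[simplified] linear_conv_bounded_linear)
  have eq: "?M = density lborel (\<lambda>_. emeasure ?M (hbox UNIV 0 1))"
  proof (rule translation_invariant_unique)
    show "emeasure ?M ((+) v ` B) = emeasure ?M B" if "B \<in> sets borel" for v B
      using that by (simp add: M borel_translation T_translate emeasure_lborel_translation T_borel)
    show "emeasure lborel (hbox UNIV 0 (1 :: real ^ 'n)) = 1"
      by (rule emeasure_lborel_unit_box) (auto simp: hbox_def mem_box_cart less_imp_le)
  qed (auto simp: emeasure_lborel_translation fin)
  define c where "c = enn2real (emeasure ?M (hbox UNIV 0 1))"
  have c: "emeasure ?M (hbox UNIV 0 1) = ennreal c" using fin by (simp add: c_def)
  \<comment> \<open>A zero constant would give the whole space measure 0, but its preimage under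
    \<open>S\<close> is the whole space.\<close>
  have "c \<noteq> 0"
  proof
    assume "c = 0"
    then have "?M = density lborel (\<lambda>_. 0)"
      using eq unfolding c by simp
    then have "emeasure ?M UNIV = emeasure (density lborel (\<lambda>_. 0)) (UNIV :: (real ^ 'n) set)"
      by (rule arg_cong)
    then show False by (simp add: M emeasure_density image_T)
  qed
  moreover have "0 \<le> c" by (simp add: c_def)
  ultimately have "0 < c" by simp
  then show ?thesis using that eq c by simp
qed

end

section \<open>Hausdorff measure of facets\<close>

text \<open>The family is padded to a sequence by empty sets, which cost nothing.\<close>

lemma hausdorff_content_finite_cover:
  assumes I: "finite I" and A: "A \<subseteq> (\<Union>k\<in>I. C k)" and \<delta>: "0 \<le> \<delta>"
    and C: "\<And>k. k \<in> I \<Longrightarrow> bounded (C k)" "\<And>k. k \<in> I \<Longrightarrow> diameter (C k) \<le> \<delta>"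
  shows "hausdorff_content d \<delta> A \<le> (\<Sum>k\<in>I. hausdorff_gauge d (C k))"
proof -
  obtain h where h: "bij_betw h {0..<card I} I" using ex_bij_betw_nat_finite[OF I] by blast
  define D where "D n = (if n < card I then C (h n) else {})" for n
  have hI: "h n \<in> I" if "n < card I" for n using h that by (auto simp: bij_betw_def)
  have "A \<subseteq> (\<Union>n. D n)"
  proof
    fix x assume "x \<in> A"
    then obtain k where k: "k \<in> I" "x \<in> C k" using A by blast
    then have "k \<in> h ` {0..<card I}" using h by (simp add: bij_betw_def)
    then obtain n where "n < card I" "x \<in> C (h n)"
      using k by auto
    then show "x \<in> (\<Union>n. D n)" by (auto simp: D_def)
  qed
  then have "D \<in> hausdorff_covers \<delta> A"
    using C hI \<delta> by (auto simp: hausdorff_covers_def D_def)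
  then have "hausdorff_content d \<delta> A \<le> (\<Sum>n. hausdorff_gauge d (D n))"
    unfolding hausdorff_content_def by (rule INF_lower)
  also have "\<dots> = (\<Sum>n\<in>{0..<card I}. hausdorff_gauge d (D n))"
    by (rule suminf_finite) (auto simp: D_def hausdorff_gauge_def)
  also have "\<dots> = (\<Sum>n\<in>{0..<card I}. hausdorff_gauge d (C (h n)))"
    by (intro sum.cong) (auto simp: D_def)
  also have "\<dots> = (\<Sum>k\<in>I. hausdorff_gauge d (C k))"
    by (rule sum.reindex_bij_betw[OF h])
  finally show ?thesis .
qed

context linear_iso
begin

abbreviation unit_facet :: "'n \<Rightarrow> (real ^ 'n) set" where
  "unit_facet i \<equiv> hbox (- {i}) 0 1 \<inter> {t. t $ i = 0}"

text \<open>
  Cutting the facet into \<open>N ^ (n - 1)\<close> congruent pieces of diameter at most \<open>K / N\<close>.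
\<close>

lemma hausdorff_outer_facet_finite:
  "hausdorff_outer (CARD('n) - 1) (T ` unit_facet i) < top"
proof -
  let ?d = "CARD('n) - 1"
  obtain B where B: "B > 0" "\<And>x. norm (T x) \<le> B * norm x"
    using linear_bounded_pos[OF linear_T] by blast
  \<comment> \<open>Coordinates within a grid cell differ by at most \<open>1 / N\<close>; the l1
    norm then bounds the distance by \<open>CARD('n) / N\<close>, and \<open>T\<close> stretches it
    by at most \<open>B\<close>.\<close>
  define K where "K = B * CARD('n)"
  have K: "0 < K" using B by (simp add: K_def)
  have "hausdorff_content ?d \<delta> (T ` unit_facet i) \<le> ennreal (unit_ball_vol (real ?d) * (K / 2) ^ ?d)"
    if \<delta>: "0 < \<delta>" for \<delta>
  proof -
    obtain N0 where "K / \<delta> < real N0" using reals_Archimedean2 by blast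
    then obtain N where N: "0 < N" "K / real N \<le> \<delta>"
    proof (rule_tac that[of "Suc N0"])
      assume "K / \<delta> < real N0"
      then have "K < real N0 * \<delta>" using \<delta> by (simp add: field_simps)
      also have "\<dots> \<le> real (Suc N0) * \<delta>" using \<delta> by (simp add: mult_right_mono)
      finally show "K / real (Suc N0) \<le> \<delta>" using \<delta> by (simp add: field_simps)
    qed simp
    define I where "I = (- {i}) \<rightarrow>\<^sub>E {..<N}"
    define C where "C k = T ` {t. t $ i = 0 \<and> (\<forall>j\<in>-{i}. real (k j) / N \<le> t $ j \<and> t $ j \<le> real (k j + 1) / N)}"
      for k
    have diam: "norm (x - y) \<le> K / N" if xy: "x \<in> C k" "y \<in> C k" for x y k
    proof -
      obtain a b where ab: "x = T a" "y = T b" "a $ i = 0" "b $ i = 0"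
        and "\<And>j. j \<noteq> i \<Longrightarrow> real (k j) / N \<le> a $ j \<and> a $ j \<le> real (k j + 1) / N"
        and "\<And>j. j \<noteq> i \<Longrightarrow> real (k j) / N \<le> b $ j \<and> b $ j \<le> real (k j + 1) / N"
        using xy by (auto simp: C_def)
      then have "\<bar>(a - b) $ j\<bar> \<le> 1 / N" for j
        by (cases "j = i") (auto simp: add_divide_distrib abs_le_iff, (smt (verit))+)
      then have "(\<Sum>j\<in>UNIV. \<bar>(a - b) $ j\<bar>) \<le> (\<Sum>j\<in>(UNIV :: 'n set). 1 / N)"
        by (intro sum_mono)
      then have "norm (a - b) \<le> CARD('n) / N"
        using norm_le_l1_cart[of "a - b"] by simp
      then have "B * norm (a - b) \<le> B * (CARD('n) / N)"
        using B by (intro mult_left_mono) auto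
      moreover have "x - y = T (a - b)" using ab linear_T by (simp add: linear_diff)
      ultimately show ?thesis using B(2)[of "a - b"] by (simp add: K_def)
    qed
    have d: "diameter (C k) \<le> K / N" for k
      using K by (intro diameter_le diam) auto
    have bdd: "bounded (C k)" for k
      unfolding bounded_two_points using diam[of _ k] by (auto simp: dist_norm)
    have cover: "T ` unit_facet i \<subseteq> (\<Union>k\<in>I. C k)"
    proof
      fix x assume "x \<in> T ` unit_facet i"
      then obtain t where t: "x = T t" "t $ i = 0" "\<And>j. j \<noteq> i \<Longrightarrow> 0 \<le> t $ j \<and> t $ j < 1"
        by (auto simp: hbox_def)
      define k where "k = restrict (\<lambda>j. nat \<lfloor>N * t $ j\<rfloor>) (- {i})"
      have kj: "k j < N \<and> real (k j) / N \<le> t $ j \<and> t $ j \<le> real (k j + 1) / N" if "j \<noteq> i" for j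
      proof -
        have "0 \<le> N * t $ j" "N * t $ j < N" using t(3)[OF that] N by auto
        then have "real (k j) \<le> N * t $ j" "N * t $ j \<le> real (k j) + 1"
          using that by (auto simp: k_def)
        moreover from this \<open>N * t $ j < N\<close> have "k j < N" by linarith
        ultimately show ?thesis using N by (simp add: field_simps)
      qed
      have "k \<in> I" using kj by (auto simp: I_def k_def)
      moreover have "x \<in> C k" using kj t by (auto simp: C_def)
      ultimately show "x \<in> (\<Union>k\<in>I. C k)" by blast
    qed
    have "hausdorff_content ?d \<delta> (T ` unit_facet i) \<le> (\<Sum>k\<in>I. hausdorff_gauge ?d (C k))"
    proof (rule hausdorff_content_finite_cover[OF _ cover])
      show "finite I" by (simp add: I_def finite_PiE)
      show "diameter (C k) \<le> \<delta>" for k using d N(2) by (rule order_trans)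
    qed (use \<delta> bdd in auto)
    also have "\<dots> \<le> (\<Sum>k\<in>I. ennreal (unit_ball_vol (real ?d) * (K / N / 2) ^ ?d))"
      using d bdd K unfolding hausdorff_gauge_def
      by (intro sum_mono) (auto intro!: ennreal_leI mult_left_mono power_mono divide_right_mono diameter_ge_0)
    also have "\<dots> = ennreal (N ^ ?d * (unit_ball_vol (real ?d) * (K / N / 2) ^ ?d))"
    proof -
      have "card I = N ^ ?d" by (simp add: I_def card_PiE Compl_eq_Diff_UNIV card_Diff_singleton)
      then show ?thesis using K by (simp add: ennreal_mult ennreal_of_nat_eq_real_of_nat)
    qed
    \<comment> \<open>The number of cells cancels the factor \<open>1 / N ^ ?d\<close> in the gauge,
      so the bound does not depend on \<delta>.\<close>
    also have "N ^ ?d * (unit_ball_vol (real ?d) * (K / N / 2) ^ ?d) = unit_ball_vol (real ?d) * (K / 2) ^ ?d"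
      using N by (simp add: power_divide)
    finally show ?thesis .
  qed
  then have "hausdorff_outer ?d (T ` unit_facet i) \<le> ennreal (unit_ball_vol (real ?d) * (K / 2) ^ ?d)"
    unfolding hausdorff_outer_def by (intro SUP_least) auto
  also have "\<dots> < top" by simp
  finally show ?thesis .
qed

text \<open>
  A cover of the facet, thickened in direction \<open>i\<close>, covers the unit cube, and a set of diameter \<open>r\<close>
  thickens to a set of Lebesgue measure at most a constant times \<open>r ^ (n - 1)\<close>.
\<close>

lemma hausdorff_outer_facet_pos:
  "0 < hausdorff_outer (CARD('n) - 1) (T ` unit_facet i)"
proof -
  let ?d = "CARD('n) - 1"
  obtain L where L: "L > 0" "\<And>x. norm (S x) \<le> L * norm x"
    using linear_bounded_pos[OF linear_S] by blast
  \<comment> \<open>The ratio between the volume \<open>(2 * L * r) ^ ?d\<close> of the thickened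
    box for diameter \<open>r\<close> and the gauge, which contains \<open>(r / 2) ^ ?d\<close>. The
    scale 1 used next is arbitrary: the content at any scale bounds the outer measure from
    below.\<close>
  define \<kappa> where "\<kappa> = (4 * L) ^ ?d / unit_ball_vol (real ?d)"
  have \<kappa>: "0 < \<kappa>" using L by (simp add: \<kappa>_def)
  have "ennreal (1 / \<kappa>) \<le> (\<Sum>k. hausdorff_gauge ?d (C k))"
    if C: "C \<in> hausdorff_covers 1 (T ` unit_facet i)" for C
  proof -
    have bdd: "bounded (C k)" for k using C by (simp add: hausdorff_covers_def)
    define y where "y k = (SOME x. x \<in> C k)" for k
    \<comment> \<open>In coordinates, \<open>C k\<close> lies within distance
      \<open>L * diameter (C k)\<close> of \<open>S (y k)\<close>; direction i gets all of [0,1]. An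
      empty \<open>C k\<close> needs an empty box, since for d = 0 the formula would give a box of
      measure 1 against a gauge of 0.\<close>
    define b where "b k = (if C k = {} then {} else
        cbox (\<chi> j. if j = i then 0 else S (y k) $ j - L * diameter (C k))
          (\<chi> j. if j = i then 1 else S (y k) $ j + L * diameter (C k)))" for k
    have meas: "emeasure lborel (b k) = ennreal \<kappa> * hausdorff_gauge ?d (C k)" for k
    proof (cases "C k = {}")
      case False
      have D: "0 \<le> diameter (C k)" by (intro diameter_ge_0 bdd)
      have "emeasure lborel (b k) = ennreal (\<Prod>j\<in>UNIV. if j = i then 1 else 2 * L * diameter (C k))"
        using D L False unfolding b_def
        by (simp add: emeasure_lborel_cbox_cart) (intro arg_cong[where f=ennreal] prod.cong; simp)
      also have "(\<Prod>j\<in>UNIV. if j = i then 1 else 2 * L * diameter (C k)) = (2 * L * diameter (C k)) ^ ?d"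
      proof -
        have "{j. j \<noteq> i} = UNIV - {i}" by auto
        then show ?thesis by (simp add: prod.If_cases Compl_eq card_Diff_singleton)
      qed
      also have "\<dots> = \<kappa> * (unit_ball_vol (real ?d) * (diameter (C k) / 2) ^ ?d)"
      proof -
        have "2 * L * diameter (C k) = 4 * L * (diameter (C k) / 2)" by simp
        then have "(2 * L * diameter (C k)) ^ ?d = (4 * L) ^ ?d * (diameter (C k) / 2) ^ ?d"
          by (metis power_mult_distrib)
        moreover have "unit_ball_vol (real ?d) \<noteq> 0" by (metis less_irrefl of_nat_0_le_iff unit_ball_vol_pos)
        ultimately show ?thesis by (simp add: \<kappa>_def)
      qed
      finally show ?thesis using False D \<kappa> by (simp add: hausdorff_gauge_def ennreal_mult)
    qed (simp add: b_def hausdorff_gauge_def)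
    have "hbox UNIV 0 1 \<subseteq> (\<Union>k. b k)"
    proof
      fix t :: "real ^ 'n" assume t: "t \<in> hbox UNIV 0 1"
      then have "T (upd i 0 t) \<in> T ` unit_facet i" by (auto simp: hbox_def)
      then obtain k where k: "T (upd i 0 t) \<in> C k"
        using C by (auto simp: hausdorff_covers_def)
      then have "y k \<in> C k" unfolding y_def by (rule someI)
      then have "dist (T (upd i 0 t)) (y k) \<le> diameter (C k)"
        using k by (intro diameter_bounded_bound bdd)
      then have "L * norm (T (upd i 0 t) - y k) \<le> L * diameter (C k)"
        using L by (simp add: dist_norm)
      moreover have "norm (upd i 0 t - S (y k)) \<le> L * norm (T (upd i 0 t) - y k)"
        using L(2)[of "T (upd i 0 t) - y k"] by (simp add: S_diff)
      ultimately have n: "norm (upd i 0 t - S (y k)) \<le> L * diameter (C k)" by simp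
      have "\<bar>t $ j - S (y k) $ j\<bar> \<le> L * diameter (C k)" if "j \<noteq> i" for j
        using component_le_norm_cart[of "upd i 0 t - S (y k)" j] n that by simp
      then have "t \<in> b k"
        using k t by (auto simp: b_def mem_box_cart hbox_def abs_le_iff less_imp_le algebra_simps)
      then show "t \<in> (\<Union>k. b k)" by blast
    qed
    moreover have b: "b k \<in> sets lborel" for k by (simp add: b_def)
    ultimately have "emeasure lborel (hbox UNIV 0 (1 :: real ^ 'n)) \<le> emeasure lborel (\<Union>k. b k)"
      by (intro emeasure_mono) auto
    also have "\<dots> \<le> (\<Sum>k. emeasure lborel (b k))"
      using b by (intro emeasure_subadditive_countably) auto
    also have "\<dots> = ennreal \<kappa> * (\<Sum>k. hausdorff_gauge ?d (C k))"
      by (simp add: meas)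
    also have "emeasure lborel (hbox UNIV 0 (1 :: real ^ 'n)) = 1"
      by (rule emeasure_lborel_unit_box) (auto simp: hbox_def mem_box_cart less_imp_le)
    finally have "ennreal (1 / \<kappa>) * 1 \<le> ennreal (1 / \<kappa>) * (ennreal \<kappa> * (\<Sum>k. hausdorff_gauge ?d (C k)))"
      by (intro mult_left_mono) auto
    then show ?thesis using \<kappa> by (simp add: mult.assoc[symmetric] ennreal_mult[symmetric])
  qed
  then have "ennreal (1 / \<kappa>) \<le> hausdorff_content ?d 1 (T ` unit_facet i)"
    unfolding hausdorff_content_def by (intro INF_greatest)
  also have "\<dots> \<le> hausdorff_outer ?d (T ` unit_facet i)"
    unfolding hausdorff_outer_def by (intro SUP_upper) auto
  finally show ?thesis by (rule less_le_trans[rotated]) (simp add: \<kappa>)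
qed

text \<open>The surface measure of a facet in direction i. The half-open facet is used because it is
  the box on which \<open>translation_invariant_unique\<close> normalises.\<close>

definition facet_const :: "'n \<Rightarrow> real" where
  "facet_const i = enn2real (hausdorff_outer (CARD('n) - 1) (T ` unit_facet i))"

lemma facet_const_pos: "0 < facet_const i"
  using hausdorff_outer_facet_finite[of i] hausdorff_outer_facet_pos[of i]
  by (simp add: facet_const_def enn2real_positive_iff)

lemma ennreal_facet_const: "ennreal (facet_const i) = hausdorff_outer (CARD('n) - 1) (T ` unit_facet i)"
  using hausdorff_outer_facet_finite[of i] by (simp add: facet_const_def)

section \<open>Surface measure on a hyperplane in facet coordinates\<close>

lemma affine_measurable [measurable]:
  "(\<lambda>x. S (x - q)) \<in> borel \<rightarrow>\<^sub>M borel" "(\<lambda>t. q + T t) \<in> borel \<rightarrow>\<^sub>M borel"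
  by (rule measurable_compose[OF _ meas(2)] borel_measurable_add measurable_const, measurable)+

lemma image_affine: "(\<lambda>t. q + T t) ` B = (\<lambda>x. S (x - q)) -` B"
proof (intro set_eqI iffI)
  fix x assume "x \<in> (\<lambda>x. S (x - q)) -` B"
  moreover have "x = q + T (S (x - q))" by simp
  ultimately show "x \<in> (\<lambda>t. q + T t) ` B" by blast
qed auto

lemma affine_borel: "B \<in> sets borel \<Longrightarrow> (\<lambda>t. q + T t) ` B \<in> sets borel"
  using measurable_sets[OF affine_measurable(1)] by (simp add: image_affine)

lemma affine_sets_hausdorff: "B \<in> sets borel \<Longrightarrow> (\<lambda>t. q + T t) ` B \<in> sets (hausdorff_measure d)"
  using affine_borel sets_borel_subset_hausdorff by blast

lemma emeasure_hausdorff_affine: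
  assumes "B \<in> sets borel"
  shows "emeasure (hausdorff_measure d) ((\<lambda>t. q + T t) ` B) = hausdorff_outer d (T ` B)"
proof -
  have "(\<lambda>t. q + T t) ` B = (+) q ` (T ` B)" by auto
  then show ?thesis
    using emeasure_hausdorff_measure[OF affine_sets_hausdorff[OF assms]] hausdorff_outer_translation
    by metis
qed

lemma hyperplane_borel: "{t :: real ^ 'n. t $ i = a} \<in> sets borel"
  by measurable

text \<open>The density restricts surface measure to one affine hyperplane and \<open>distr\<close>
  pulls it back to the coordinates \<open>t\<close>, giving a Borel measure on
  \<open>real ^ 'n\<close> concentrated on \<open>t $ i = 0\<close>.\<close>

lemma emeasure_distr_hyperplane:
  assumes B: "B \<in> sets borel"
  shows "emeasure (distr (density surface_measure (\<lambda>x. ennreal (indicator ((\<lambda>t. q + T t) ` {t. t $ i = 0}) x))) borel (\<lambda>x. S (x - q))) B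
    = emeasure surface_measure ((\<lambda>t. q + T t) ` (B \<inter> {t. t $ i = 0}))"
proof -
  let ?d = "CARD('n) - 1"
  have X: "(\<lambda>t. q + T t) ` {t. t $ i = 0} \<in> sets (hausdorff_measure ?d)"
    by (rule affine_sets_hausdorff[OF hyperplane_borel])
  have V: "(\<lambda>x. S (x - q)) -` B \<in> sets (hausdorff_measure ?d)"
    using affine_sets_hausdorff[OF B, of q] by (simp add: image_affine)
  have S_meas: "(\<lambda>x. S (x - q)) \<in> borel_measurable (hausdorff_measure ?d)"
    by (rule measurable_hausdorff_borel[OF affine_measurable(1)])
  have "emeasure (distr (density surface_measure (\<lambda>x. ennreal (indicator ((\<lambda>t. q + T t) ` {t. t $ i = 0}) x))) borel (\<lambda>x. S (x - q))) B
      = emeasure (density surface_measure (\<lambda>x. ennreal (indicator ((\<lambda>t. q + T t) ` {t. t $ i = 0}) x))) ((\<lambda>x. S (x - q)) -` B)"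
    using B S_meas by (subst emeasure_distr) (auto simp: measurable_def)
  also have "\<dots> = emeasure surface_measure ((\<lambda>x. S (x - q)) -` B \<inter> (\<lambda>t. q + T t) ` {t. t $ i = 0})"
    using X V by (subst emeasure_density)
      (auto simp: ennreal_indicator indicator_inter_arith[symmetric] mult.commute)
  also have "(\<lambda>x. S (x - q)) -` B \<inter> (\<lambda>t. q + T t) ` {t. t $ i = 0} = (\<lambda>t. q + T t) ` (B \<inter> {t. t $ i = 0})"
    by (auto simp: image_affine)
  finally show ?thesis .
qed

text \<open>The projected slab plays the part of (n - 1)-dimensional Lebesgue measure on the
  hyperplane \<open>t $ i = 0\<close>.\<close>

lemma emeasure_distr_slab:
  fixes B :: "(real ^ 'n) set"
  assumes B: "B \<in> sets borel"
  shows "emeasure (distr (density lborel (\<lambda>t. ennreal (indicator {t. 0 < t $ i \<and> t $ i < 1} t))) borel (upd i 0)) B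
    = emeasure lborel (upd i 0 -` B \<inter> {t. 0 < t $ i \<and> t $ i < 1})"
proof -
  have [measurable]: "{t :: real ^ 'n. 0 < t $ i \<and> t $ i < 1} \<in> sets borel" by measurable
  have "upd i 0 -` B \<in> sets borel" using measurable_sets_borel[OF borel_measurable_upd B] .
  then show ?thesis using B
    by (subst emeasure_distr, simp, simp, subst emeasure_density)
      (auto simp: ennreal_indicator indicator_inter_arith[symmetric] Int_commute)
qed

text \<open>Both measures are concentrated on the hyperplane and invariant under translations
  parallel to it: Hausdorff measure because such translations are isometries after applying
  \<open>T\<close> as well, the slab because they preserve it and commute with the projection.
  Uniqueness makes them proportional.\<close>

lemma hausdorff_hyperplane:
  "distr (density surface_measure (\<lambda>x. ennreal (indicator ((\<lambda>t. q + T t) ` {t. t $ i = 0}) x))) borel (\<lambda>x. S (x - q))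
    = density (distr (density lborel (\<lambda>t. ennreal (indicator {t. 0 < t $ i \<and> t $ i < 1} t))) borel (upd i 0))
        (\<lambda>_. ennreal (facet_const i))"
  (is "?M = density ?N _")
proof -
  let ?d = "CARD('n) - 1"
  have M: "emeasure ?M B = hausdorff_outer ?d (T ` (B \<inter> {t. t $ i = 0}))" if B: "B \<in> sets borel" for B
    unfolding emeasure_distr_hyperplane[OF B]
    using B hyperplane_borel by (intro emeasure_hausdorff_affine) auto
  note N = emeasure_distr_slab[of _ i]
  have c: "emeasure ?M (hbox (- {i}) 0 1) = ennreal (facet_const i)"
    using M[OF hbox_borel] by (simp only: ennreal_facet_const)
  show ?thesis unfolding c[symmetric]
  proof (rule translation_invariant_unique)
    fix v :: "real ^ 'n" and B :: "(real ^ 'n) set"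
    assume v': "\<And>j. j \<notin> - {i} \<Longrightarrow> v $ j = 0" and B: "B \<in> sets borel"
    then have v: "v $ i = 0" by simp
    have "(+) v ` B \<inter> {t. t $ i = 0} = (+) v ` (B \<inter> {t. t $ i = 0})"
      using v by auto
    then show "emeasure ?M ((+) v ` B) = emeasure ?M B"
      unfolding M[OF borel_translation[OF B]] M[OF B]
      by (simp add: T_translate hausdorff_outer_translation)
    have "upd i 0 -` ((+) v ` B) \<inter> {t. 0 < t $ i \<and> t $ i < 1} = (+) v ` (upd i 0 -` B \<inter> {t. 0 < t $ i \<and> t $ i < 1})"
    proof (intro set_eqI iffI)
      fix t assume t: "t \<in> upd i 0 -` ((+) v ` B) \<inter> {t. 0 < t $ i \<and> t $ i < 1}"
      then obtain b where b: "b \<in> B" "upd i 0 t = v + b" by auto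
      then have "b = upd i 0 t - v" by simp
      then have "upd i 0 (t - v) = b" using v by (simp add: vec_eq_iff)
      then have "t - v \<in> upd i 0 -` B \<inter> {t. 0 < t $ i \<and> t $ i < 1}" using b t v by simp
      moreover have "t = v + (t - v)" by simp
      ultimately show "t \<in> (+) v ` (upd i 0 -` B \<inter> {t. 0 < t $ i \<and> t $ i < 1})" by blast
    next
      fix t assume "t \<in> (+) v ` (upd i 0 -` B \<inter> {t. 0 < t $ i \<and> t $ i < 1})"
      then obtain b where b: "t = v + b" "upd i 0 b \<in> B" "0 < b $ i" "b $ i < 1" by auto
      have "upd i 0 t = v + upd i 0 b" using b v by (simp add: vec_eq_iff)
      then have "upd i 0 t \<in> (+) v ` B" using b(2) by blast
      moreover have "0 < t $ i \<and> t $ i < 1" using b v by simp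
      ultimately show "t \<in> upd i 0 -` ((+) v ` B) \<inter> {t. 0 < t $ i \<and> t $ i < 1}"
        by blast
    qed
    then show "emeasure ?N ((+) v ` B) = emeasure ?N B"
      unfolding N[OF borel_translation[OF B]] N[OF B]
      using measurable_sets_borel[OF borel_measurable_upd B, of i 0]
      by (simp add: emeasure_lborel_translation)
  next
    fix j :: 'n assume "j \<notin> - {i}"
    then have [simp]: "j = i" by simp
    have m: "{t :: real ^ 'n. t $ j \<noteq> 0} \<in> sets borel" by measurable
    have "{t :: real ^ 'n. t $ j \<noteq> 0} \<inter> {t. t $ i = 0} = {}" by auto
    then show "emeasure ?M {t. t $ j \<noteq> 0} = 0" using M[OF m] by simp
    have "upd i 0 -` {t :: real ^ 'n. t $ j \<noteq> 0} = {}" by auto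
    then show "emeasure ?N {t. t $ j \<noteq> 0} = 0" using N[OF m] by simp
  next
    show "emeasure ?M (hbox (- {i}) 0 1) < top" unfolding c by simp
    show "emeasure ?N (hbox (- {i}) 0 1) = 1"
    proof (subst N)
      show "emeasure lborel (upd i 0 -` hbox (- {i}) 0 1 \<inter> {t. 0 < t $ i \<and> t $ i < 1}) = 1"
      proof (rule emeasure_lborel_unit_box)
        show "upd i 0 -` hbox (- {i}) 0 1 \<inter> {t. 0 < t $ i \<and> t $ i < 1} \<in> sets borel"
          using measurable_sets_borel[OF borel_measurable_upd hbox_borel] by auto
        show "upd i 0 -` hbox (- {i}) 0 1 \<inter> {t. 0 < t $ i \<and> t $ i < 1} \<subseteq> cbox 0 1"
        proof
          fix t assume t: "t \<in> upd i 0 -` hbox (- {i}) 0 1 \<inter> {t. 0 < t $ i \<and> t $ i < 1}"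
          have "0 \<le> t $ j \<and> t $ j \<le> 1" for j
            using t by (cases "j = i") (auto simp: hbox_def less_imp_le)
          then show "t \<in> cbox 0 1" by (simp add: mem_box_cart)
        qed
      qed (auto simp: hbox_def mem_box_cart less_imp_le)
    qed auto
  qed auto
qed

lemma emeasure_hausdorff_hyperplane:
  assumes B: "B \<in> sets borel"
  shows "emeasure surface_measure ((\<lambda>t. q + T t) ` (B \<inter> {t. t $ i = 0})) =
    ennreal (facet_const i) * emeasure lborel (upd i 0 -` B \<inter> {t. 0 < t $ i \<and> t $ i < 1})"
  unfolding emeasure_distr_hyperplane[OF B, symmetric] emeasure_distr_slab[OF B, symmetric]
    hausdorff_hyperplane
  using B by (simp add: emeasure_density nn_integral_cmult_indicator)

lemma integral_hausdorff_hyperplane: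
  fixes g :: "real ^ 'n \<Rightarrow> real"
  assumes g [measurable]: "g \<in> borel_measurable borel"
  shows "(LINT x:(\<lambda>t. q + T t) ` {t. t $ i = 0}|surface_measure. g x) =
    facet_const i * (LINT t:{t. 0 < t $ i \<and> t $ i < 1}|lborel. g (q + T (upd i 0 t)))"
proof -
  let ?X = "(\<lambda>t. q + T t) ` {t. t $ i = 0}"
  have X: "?X \<in> sets surface_measure" by (rule affine_sets_hausdorff[OF hyperplane_borel])
  have [measurable]: "{t :: real ^ 'n. 0 < t $ i \<and> t $ i < 1} \<in> sets borel" by measurable
  have S_meas: "(\<lambda>x. S (x - q)) \<in> borel_measurable surface_measure"
    by (rule measurable_hausdorff_borel[OF affine_measurable(1)])
  have gm: "(\<lambda>t. g (q + T t)) \<in> borel_measurable borel" by measurable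
  have "(LINT x:?X|surface_measure. g x) =
      (LINT x|density surface_measure (\<lambda>x. ennreal (indicator ?X x)). g x)"
    using X measurable_hausdorff_borel[OF g]
    by (simp add: integral_density set_lebesgue_integral_def)
  also have "\<dots> = (LINT t|distr (density surface_measure (\<lambda>x. ennreal (indicator ?X x))) borel (\<lambda>x. S (x - q)).
      g (q + T t))"
    using S_meas gm by (subst integral_distr) (auto simp: measurable_def)
  also have "\<dots> = facet_const i * (LINT t|distr (density lborel (\<lambda>t. ennreal (indicator {t. 0 < t $ i \<and> t $ i < 1} t))) borel (upd i 0).
      g (q + T t))"
    unfolding hausdorff_hyperplane using gm facet_const_pos[of i]
    by (subst integral_density) auto
  also have "(LINT t|distr (density lborel (\<lambda>t. ennreal (indicator {t. 0 < t $ i \<and> t $ i < 1} t))) borel (upd i 0).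
      g (q + T t)) = (LINT t:{t. 0 < t $ i \<and> t $ i < 1}|lborel. g (q + T (upd i 0 t)))"
    using measurable_compose[OF borel_measurable_upd gm] gm
    by (subst integral_distr, simp, simp, subst integral_density) (auto simp: set_lebesgue_integral_def)
  finally show ?thesis .
qed

text \<open>The slab lying over such a lower dimensional face is part of a hyperplane of
  \<open>real ^ 'n\<close>, hence Lebesgue null.\<close>

lemma null_facet_boundary:
  assumes "j \<noteq> i"
  shows "(\<lambda>t. q + T t) ` ({t. t $ j = a} \<inter> {t. t $ i = 0}) \<in> null_sets surface_measure"
proof -
  have "upd i 0 -` {t. t $ j = a} = {t. t $ j = a}" using assms by auto
  moreover have "emeasure lborel ({t. t $ j = a} \<inter> {t. 0 < t $ i \<and> t $ i < 1}) = 0"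
    by (rule emeasure_eq_0[OF null_setsD2[OF null_sets_lborel_hyperplane[of j a]]
          null_setsD1[OF null_sets_lborel_hyperplane[of j a]]]) auto
  ultimately have "emeasure surface_measure ((\<lambda>t. q + T t) ` ({t. t $ j = a} \<inter> {t. t $ i = 0})) = 0"
    using emeasure_hausdorff_hyperplane[OF hyperplane_borel, of q j a i] by simp
  then show ?thesis
    using affine_sets_hausdorff[of "{t. t $ j = a} \<inter> {t. t $ i = 0}" q] hyperplane_borel
    by (auto simp: null_sets_def)
qed

text \<open>Only continuity over the relative interior of the facet is available, so
  \<open>f\<close> is replaced by a Borel function \<open>g\<close> that agrees with it on the facet
  outside the null set \<open>N\<close>.\<close>

lemma facet_integral:
  fixes f :: "real ^ 'n \<Rightarrow> real" and q :: "real ^ 'n" and i :: 'n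
  defines "F \<equiv> (\<lambda>t. q + T t) ` (cbox 0 1 \<inter> {t. t $ i = 0})"
  assumes cont: "continuous_on {t. \<forall>j\<in>-{i}. 0 < t $ j \<and> t $ j < 1} (\<lambda>t. f (q + T (upd i 0 t)))"
    and bdd: "\<And>x. x \<in> F \<Longrightarrow> \<bar>f x\<bar> \<le> b"
  shows "set_integrable surface_measure F f"
    and "(LINT x:F|surface_measure. f x) =
      facet_const i * (LINT t:box 0 1|lborel. f (q + T (upd i 0 t)))"
proof -
  interpret complete_measure "surface_measure :: (real ^ 'n) measure" by (rule complete_measure_hausdorff)
  let ?X = "(\<lambda>t. q + T t) ` {t. t $ i = 0}" and ?U = "{t :: real ^ 'n. 0 < t $ i \<and> t $ i < 1}"
  define V where "V = {t :: real ^ 'n. \<forall>j\<in>-{i}. 0 < t $ j \<and> t $ j < 1}"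
  have V: "V \<in> sets borel"
  proof -
    have "V = (\<Inter>j\<in>-{i}. {t. 0 < t $ j} \<inter> {t. t $ j < 1}) \<inter> UNIV" by (auto simp: V_def)
    also have "\<dots> \<in> sets borel" by (cases "- {i} = {}") (auto intro!: sets.finite_INT)
    finally show ?thesis .
  qed
  \<comment> \<open>\<open>V\<close> leaves coordinate i free because the integrand ignores it; this
    makes \<open>G\<close> Borel on all of \<open>real ^ 'n\<close>.\<close>
  define G where "G t = indicator V t * f (q + T (upd i 0 t))" for t
  have G [measurable]: "G \<in> borel_measurable borel"
    using borel_measurable_continuous_on_indicator[OF V cont[folded V_def]] by (simp add: G_def[abs_def])
  define g where "g x = G (S (x - q))" for x
  have g: "g \<in> borel_measurable borel" unfolding g_def by measurable
  define N where "N = (\<Union>j\<in>-{i}. \<Union>a\<in>{0,1}. (\<lambda>t. q + T t) ` ({t. t $ j = a} \<inter> {t. t $ i = 0}))"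
  have N: "N \<in> null_sets surface_measure"
    unfolding N_def by (intro null_sets.finite_UN null_facet_boundary) auto
  have X: "?X \<in> sets surface_measure" by (rule affine_sets_hausdorff[OF hyperplane_borel])
  have eq: "indicator F x *\<^sub>R f x = indicator ?X x *\<^sub>R g x" if "x \<notin> N" for x
  proof -
    define t where "t = S (x - q)"
    have x: "x = q + T t" by (simp add: t_def)
    have F: "x \<in> F \<longleftrightarrow> t \<in> cbox 0 1 \<and> t $ i = 0" and X: "x \<in> ?X \<longleftrightarrow> t $ i = 0"
      unfolding F_def image_affine by (auto simp: t_def)
    have "t \<in> V \<longleftrightarrow> t \<in> cbox 0 1" if ti: "t $ i = 0"
    proof
      assume "t \<in> V"
      then have "0 \<le> t $ j \<and> t $ j \<le> 1" for j
        using ti by (cases "j = i") (auto simp: V_def less_imp_le)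
      then show "t \<in> cbox 0 1" by (simp add: mem_box_cart)
    next
      assume t: "t \<in> cbox 0 1"
      have "0 < t $ j \<and> t $ j < 1" if "j \<noteq> i" for j
      proof -
        have "t $ j \<noteq> 0" "t $ j \<noteq> 1"
          using \<open>x \<notin> N\<close> ti that unfolding N_def image_affine by (auto simp: t_def[symmetric])
        moreover have "0 \<le> t $ j" "t $ j \<le> 1" using t by (auto simp: mem_box_cart)
        ultimately show ?thesis by simp
      qed
      then show "t \<in> V" by (auto simp: V_def)
    qed
    moreover have "upd i 0 t = t" if "t $ i = 0" using that by (simp add: vec_eq_iff)
    ultimately show ?thesis
      by (auto simp: indicator_def F X g_def G_def t_def[symmetric] x[symmetric])
  qed
  have gX: "(\<lambda>x. indicator ?X x *\<^sub>R g x) \<in> borel_measurable surface_measure"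
    using X measurable_hausdorff_borel[OF g] by measurable
  have fm: "(\<lambda>x. indicator F x *\<^sub>R f x) \<in> borel_measurable surface_measure"
    by (rule borel_measurable_cong_null[OF gX N]) (use eq in auto)
  have "upd i 0 -` cbox 0 1 \<inter> ?U \<subseteq> cbox 0 1"
  proof
    fix t assume t: "t \<in> upd i 0 -` cbox 0 1 \<inter> ?U"
    then have "upd i 0 t \<in> cbox 0 1" by simp
    then have "0 \<le> t $ j \<and> t $ j \<le> 1" for j
      using t unfolding mem_box_cart by (cases "j = i") (auto dest: spec[of _ j])
    then show "t \<in> cbox 0 1" by (simp add: mem_box_cart)
  qed
  then have "emeasure surface_measure F \<le> ennreal (facet_const i) * emeasure lborel (cbox 0 (1 :: real ^ 'n))"
    unfolding F_def emeasure_hausdorff_hyperplane[OF borel_closed[OF closed_cbox]]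
    by (intro mult_left_mono emeasure_mono) auto
  also have "\<dots> < top" by (simp add: ennreal_mult_less_top emeasure_lborel_cbox_finite[simplified])
  finally have fin: "emeasure surface_measure F < top" .
  have F: "F \<in> sets surface_measure"
    unfolding F_def using hyperplane_borel by (intro affine_sets_hausdorff) auto
  show "set_integrable surface_measure F f"
    unfolding set_integrable_def
    by (rule integrableI_bounded_set[OF F fm, where B=b])
      (use fin bdd in \<open>auto split: split_indicator\<close>)
  have "(LINT x:F|surface_measure. f x) = (LINT x:?X|surface_measure. g x)"
    unfolding set_lebesgue_integral_def
  proof (rule integral_cong_AE[OF fm gX])
    show "AE x in surface_measure. indicator F x *\<^sub>R f x = indicator ?X x *\<^sub>R g x"
      using AE_not_in[OF N] by eventually_elim (rule eq)
  qed
  also have "\<dots> = facet_const i * (LINT t:?U|lborel. g (q + T (upd i 0 t)))"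
    by (rule integral_hausdorff_hyperplane[OF g])
  also have "(LINT t:?U|lborel. g (q + T (upd i 0 t))) = (LINT t:box 0 1|lborel. f (q + T (upd i 0 t)))"
  proof -
    have "upd i 0 (upd i 0 t) = upd i 0 t" for t :: "real ^ 'n" by (simp add: vec_eq_iff)
    moreover have "t \<in> box 0 1 \<longleftrightarrow> t \<in> ?U \<and> upd i 0 t \<in> V" for t
      by (auto simp: V_def mem_box_cart)
    ultimately show ?thesis
      unfolding set_lebesgue_integral_def
      by (intro Bochner_Integration.integral_cong) (auto simp: g_def G_def indicator_def)
  qed
  finally show "(LINT x:F|surface_measure. f x) = facet_const i * (LINT t:box 0 1|lborel. f (q + T (upd i 0 t)))" .
qed

end

section \<open>Convex functions on the unit cube\<close>

lemma cube_convex_hull_finite: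
  obtains K :: "(real ^ 'n::finite) set" where "finite K" "cbox 0 1 = convex hull K"
proof -
  have "(1 :: real ^ 'n) = \<Sum>Basis"
  proof (rule euclidean_eqI)
    fix b :: "real ^ 'n" assume b: "b \<in> Basis"
    have "(\<Sum>a\<in>Basis. 1 *\<^sub>R a) \<bullet> b = (1 :: real)" using inner_sum_left_Basis[OF b] .
    moreover have "(1 :: real ^ 'n) \<bullet> b = 1" using b by (auto simp: Basis_vec_def inner_axis)
    ultimately show "(1 :: real ^ 'n) \<bullet> b = \<Sum>Basis \<bullet> b" by simp
  qed
  then show ?thesis using unit_cube_convex_hull that by metis
qed

text \<open>Above, the values at finitely many points spanning the cube bound \<open>h\<close>.
  Below, \<open>t\<close> and \<open>1 - t\<close> are symmetric about the centre \<open>m\<close>,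
  so an upper bound at \<open>1 - t\<close> gives a lower bound at \<open>t\<close>.\<close>

lemma convex_on_cube_bounded:
  fixes h :: "real ^ 'n::finite \<Rightarrow> real"
  assumes h: "convex_on (cbox 0 1) h"
  obtains b where "\<And>t. t \<in> cbox 0 1 \<Longrightarrow> \<bar>h t\<bar> \<le> b"
proof -
  obtain K :: "(real ^ 'n) set" where K: "finite K" "cbox 0 1 = convex hull K"
    by (rule cube_convex_hull_finite)
  define M where "M = Max (insert 0 (h ` K))"
  have "\<forall>t\<in>K. h t \<le> M" using K by (auto simp: M_def)
  then have upper: "h t \<le> M" if "t \<in> cbox 0 1" for t
    using convex_on_convex_hull_bound[of K h M] h K that by auto
  define m :: "real ^ 'n" where "m = (\<chi> j. 1 / 2)"
  have lower: "2 * h m - M \<le> h t" if t: "t \<in> cbox 0 1" for t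
  proof -
    have t': "1 - t \<in> cbox 0 1" using t by (auto simp: mem_box_cart)
    have "m = (1 - 1/2) *\<^sub>R t + (1/2) *\<^sub>R (1 - t)" by (simp add: m_def vec_eq_iff field_simps)
    then have "h m \<le> (1 - 1/2) * h t + (1/2) * h (1 - t)"
      using convex_onD[OF h, of "1/2" t "1 - t"] t t' by simp
    then show ?thesis using upper[OF t'] by simp
  qed
  show ?thesis
  proof (rule that[of "\<bar>M\<bar> + \<bar>2 * h m - M\<bar>"])
    fix t :: "real ^ 'n" assume "t \<in> cbox 0 1"
    then show "\<bar>h t\<bar> \<le> \<bar>M\<bar> + \<bar>2 * h m - M\<bar>" using upper[of t] lower[of t] by linarith
  qed
qed

lemma upd_cbox: "t \<in> cbox 0 1 \<Longrightarrow> s \<in> {0..1} \<Longrightarrow> upd i s t \<in> cbox 0 1"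
  by (auto simp: mem_box_cart)

lemma open_slab: "open {t :: real ^ 'n::finite. \<forall>j\<in>-{i}. 0 < t $ j \<and> t $ j < 1}"
proof -
  have "{t :: real ^ 'n. \<forall>j\<in>-{i}. 0 < t $ j \<and> t $ j < 1} = (\<Inter>j\<in>-{i}. {t. 0 < t $ j} \<inter> {t. t $ j < 1})"
    by auto
  also have "open \<dots>" by (intro open_INT open_Int open_Collect_less ballI continuous_intros) auto
  finally show ?thesis .
qed

lemma convex_slab: "convex {t :: real ^ 'n::finite. \<forall>j\<in>-{i}. 0 < t $ j \<and> t $ j < 1}"
proof (rule convexI, safe)
  fix x y :: "real ^ 'n" and u v :: real and j
  assume "\<forall>j\<in>-{i}. 0 < x $ j \<and> x $ j < 1" "\<forall>j\<in>-{i}. 0 < y $ j \<and> y $ j < 1" "0 \<le> u" "0 \<le> v" "u + v = 1"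
    and j: "j \<noteq> i"
  then have "u *\<^sub>R x $ j + v *\<^sub>R y $ j \<in> {0<..<1}"
    by (intro convexD[OF convex_real_interval(8)]) auto
  then show "0 < (u *\<^sub>R x + v *\<^sub>R y) $ j" "(u *\<^sub>R x + v *\<^sub>R y) $ j < 1" by auto
qed

text \<open>Freezing coordinate i extends the function on the facet to a convex function on a
  full-dimensional open set, where convexity implies continuity. This replaces the relative topology
  of the facet.\<close>

lemma continuous_on_upd_convex:
  fixes h :: "real ^ 'n::finite \<Rightarrow> real"
  assumes h: "convex_on (cbox 0 1) h" and s: "s \<in> {0..1}"
  shows "continuous_on {t. \<forall>j\<in>-{i}. 0 < t $ j \<and> t $ j < 1} (\<lambda>t. h (upd i s t))"
proof (rule convex_on_continuous[OF open_slab convex_onI[OF _ convex_slab]])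
  fix u :: real and x y :: "real ^ 'n"
  assume u: "0 < u" "u < 1" and x: "x \<in> {t. \<forall>j\<in>-{i}. 0 < t $ j \<and> t $ j < 1}"
    and y: "y \<in> {t. \<forall>j\<in>-{i}. 0 < t $ j \<and> t $ j < 1}"
  have "upd i s x \<in> cbox 0 1" "upd i s y \<in> cbox 0 1"
    using x y s by (auto simp: mem_box_cart less_imp_le)
  moreover have "upd i s ((1 - u) *\<^sub>R x + u *\<^sub>R y) = (1 - u) *\<^sub>R upd i s x + u *\<^sub>R upd i s y"
    by (simp add: vec_eq_iff algebra_simps)
  ultimately show "h (upd i s ((1 - u) *\<^sub>R x + u *\<^sub>R y)) \<le> (1 - u) * h (upd i s x) + u * h (upd i s y)"
    using convex_onD[OF h, of u "upd i s x" "upd i s y"] u by simp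
qed

lemma set_integrable_unit_box:
  fixes k :: "real ^ 'n::finite \<Rightarrow> real"
  assumes k: "continuous_on (box 0 1) k" and b: "\<And>t. t \<in> box 0 1 \<Longrightarrow> \<bar>k t\<bar> \<le> b"
  shows "set_integrable lborel (box 0 1) k"
  unfolding set_integrable_def
proof (rule integrableI_bounded_set[of "box 0 1"])
  show "(\<lambda>x. indicator (box 0 1) x *\<^sub>R k x) \<in> borel_measurable lborel"
    using borel_measurable_continuous_on_indicator[OF _ k] by simp
  show "AE x in lborel. x \<in> box 0 1 \<longrightarrow> norm (indicator (box 0 1) x *\<^sub>R k x) \<le> b"
    using b by (auto split: split_indicator)
qed (use emeasure_lborel_box_finite in auto)

section \<open>Symmetrisation in one coordinate\<close>

abbreviation reflect :: "'n::finite \<Rightarrow> real ^ 'n \<Rightarrow> real ^ 'n" where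
  "reflect i t \<equiv> (\<chi> j. if j = i then 1 - t $ j else t $ j)"

text \<open>Up to a translation the reflection is diagonal with entries 1 and -1, given by
  \<open>c\<close>, so the volume factor is 1.\<close>

lemma lborel_distr_reflect:
  fixes i :: "'n::finite"
  shows "distr lborel borel (reflect i) = lborel"
proof -
  define c where "c = (\<lambda>b :: real ^ 'n. if b = axis i 1 then - 1 else 1 :: real)"
  have eq: "reflect i x = axis i 1 + (\<Sum>b\<in>Basis. (c b * (x \<bullet> b)) *\<^sub>R b)" for x
  proof -
    have "(\<Sum>b\<in>Basis. (c b * (x \<bullet> b)) *\<^sub>R b) $ k = c (axis k 1) * x $ k" for k
    proof -
      have "(\<Sum>b\<in>Basis. (c b * (x \<bullet> b)) *\<^sub>R b) $ k = (\<Sum>b\<in>Basis. (c b * (x \<bullet> b)) *\<^sub>R b) \<bullet> axis k 1"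
        by (simp add: inner_axis)
      also have "\<dots> = c (axis k 1) * (x \<bullet> axis k 1)"
        by (rule inner_sum_left_Basis) simp
      finally show ?thesis by (simp add: inner_axis)
    qed
    moreover have "c (axis k 1) = (if k = i then - 1 else 1)" for k
      by (simp add: c_def axis_eq_axis)
    moreover have "axis i 1 $ k = (if k = i then 1 else 0 :: real)" for k
      by (simp add: axis_def)
    ultimately show ?thesis unfolding vec_eq_iff vector_add_component by simp
  qed
  have "lborel = density (distr lborel borel (\<lambda>x. axis i 1 + (\<Sum>b\<in>Basis. (c b * (x \<bullet> b)) *\<^sub>R b)))
      (\<lambda>_. ennreal (\<Prod>b\<in>Basis. \<bar>c b\<bar>))"
    by (rule lborel_affine_euclidean) (simp add: c_def)
  moreover have "(\<Prod>b\<in>Basis. \<bar>c b\<bar>) = 1" by (rule prod.neutral) (simp add: c_def)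
  ultimately show ?thesis by (simp add: eq density_1)
qed

lemma reflect_box: "reflect i t \<in> box 0 1 \<longleftrightarrow> t \<in> box 0 1"
proof -
  have "(0 < reflect i t $ j \<and> reflect i t $ j < 1) = (0 < t $ j \<and> t $ j < 1)" for j by auto
  then show ?thesis by (simp add: mem_box_cart)
qed

lemma continuous_reflect: "continuous_on A (reflect i)"
proof (rule continuous_on_vec_lambda)
  show "continuous_on A (\<lambda>x. if j = i then 1 - x $ j else x $ j)" for j
    by (cases "j = i") (auto intro!: continuous_intros)
qed

text \<open>
  On the segment through \<open>t\<close> in direction \<open>i\<close>, convexity bounds \<open>h t + h (reflect i t)\<close> by the sum of
  the values at the two endpoints.
\<close>

lemma integral_cube_le_facets:
  fixes h :: "real ^ 'n::finite \<Rightarrow> real"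
  assumes h: "convex_on (cbox 0 1) h"
  shows "2 * (LINT t:box 0 1|lborel. h t) \<le>
    (LINT t:box 0 1|lborel. h (upd i 0 t)) + (LINT t:box 0 1|lborel. h (upd i 1 t))"
proof -
  obtain b where b: "\<And>t. t \<in> cbox 0 1 \<Longrightarrow> \<bar>h t\<bar> \<le> b" using convex_on_cube_bounded[OF h] by blast
  have sub: "t \<in> cbox 0 1" if "t \<in> box 0 1" for t :: "real ^ 'n" using that box_subset_cbox by blast
  have "continuous_on (box 0 1) h"
    by (intro convex_on_continuous convex_on_subset[OF h] box_subset_cbox) auto
  then have ih: "set_integrable lborel (box 0 1) h"
    by (rule set_integrable_unit_box) (use b sub in auto)
  have iu: "set_integrable lborel (box 0 1) (\<lambda>t. h (upd i s t))" if s: "s \<in> {0..1}" for s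
  proof (rule set_integrable_unit_box[OF continuous_on_subset[OF continuous_on_upd_convex[OF h s, of i]]])
    show "\<bar>h (upd i s t)\<bar> \<le> b" if "t \<in> box 0 1" for t
      using b[OF upd_cbox[OF sub[OF that] s]] .
  qed (auto simp: mem_box_cart)
  have cr: "continuous_on (box 0 1) (\<lambda>t. h (reflect i t))"
    by (rule continuous_on_compose2[OF \<open>continuous_on (box 0 1) h\<close> continuous_reflect]) (auto simp: reflect_box)
  have ir: "set_integrable lborel (box 0 1) (\<lambda>t. h (reflect i t))"
    by (rule set_integrable_unit_box[OF cr]) (use b sub reflect_box in blast)
  have hm: "(\<lambda>t. indicator (box 0 1) t *\<^sub>R h t) \<in> borel_measurable borel"
    using ih by (simp add: set_integrable_def borel_measurable_integrable)
  have rm: "reflect i \<in> borel \<rightarrow>\<^sub>M borel"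
    by (intro borel_measurable_continuous_onI continuous_reflect)
  \<comment> \<open>Averaging with the reflected function makes the weights \<open>t $ i\<close> and
    \<open>1 - t $ i\<close> of each endpoint add up to 1, so the inequality holds under the
    integral sign.\<close>
  have "(LINT t:box 0 1|lborel. h t) = (LINT t:box 0 1|distr lborel borel (reflect i). h t)"
    by (simp add: lborel_distr_reflect)
  also have "\<dots> = (LINT t:box 0 1|lborel. h (reflect i t))"
    unfolding set_lebesgue_integral_def
    by (subst integral_distr[OF _ hm]) (use rm in \<open>auto simp: indicator_def reflect_box\<close>)
  finally have "2 * (LINT t:box 0 1|lborel. h t) =
      (LINT t:box 0 1|lborel. h t) + (LINT t:box 0 1|lborel. h (reflect i t))" by simp
  also have "\<dots> = (LINT t:box 0 1|lborel. h t + h (reflect i t))"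
    by (rule set_integral_add(2)[OF ih ir, symmetric])
  also have "\<dots> \<le> (LINT t:box 0 1|lborel. h (upd i 0 t) + h (upd i 1 t))"
  proof (rule set_integral_mono)
    show "set_integrable lborel (box 0 1) (\<lambda>t. h t + h (reflect i t))"
      by (rule set_integral_add(1)[OF ih ir])
    show "set_integrable lborel (box 0 1) (\<lambda>t. h (upd i 0 t) + h (upd i 1 t))"
      by (rule set_integral_add(1)) (auto intro: iu)
    fix t :: "real ^ 'n" assume t: "t \<in> box 0 1"
    then have ti: "0 \<le> t $ i" "t $ i \<le> 1" by (auto simp: mem_box_cart less_imp_le)
    have u: "upd i 0 t \<in> cbox 0 1" "upd i 1 t \<in> cbox 0 1" using upd_cbox[OF sub[OF t]] by auto
    have "t = (1 - t $ i) *\<^sub>R upd i 0 t + t $ i *\<^sub>R upd i 1 t"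
      by (simp add: vec_eq_iff algebra_simps)
    then have "h t \<le> (1 - t $ i) * h (upd i 0 t) + t $ i * h (upd i 1 t)"
      using convex_onD[OF h ti u] by simp
    moreover have "reflect i t = (1 - (1 - t $ i)) *\<^sub>R upd i 0 t + (1 - t $ i) *\<^sub>R upd i 1 t"
      by (simp add: vec_eq_iff algebra_simps)
    then have "h (reflect i t) \<le> (1 - (1 - t $ i)) * h (upd i 0 t) + (1 - t $ i) * h (upd i 1 t)"
      using convex_onD[OF h _ _ u, of "1 - t $ i"] ti by simp
    ultimately show "h t + h (reflect i t) \<le> h (upd i 0 t) + h (upd i 1 t)"
      by (simp add: algebra_simps)
  qed
  also have "\<dots> = (LINT t:box 0 1|lborel. h (upd i 0 t)) + (LINT t:box 0 1|lborel. h (upd i 1 t))"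
    by (rule set_integral_add(2)) (auto intro: iu)
  finally show ?thesis .
qed

section \<open>Parallelotopes\<close>

context linear_iso
begin

text \<open>The frontier of a convex set is null and \<open>f\<close> is continuous in the interior,
  where \<open>lborel_distr_S\<close> changes variables. \<open>c\<close> is fixed before
  \<open>f\<close>, so the constant function 1 can later identify it as the volume.\<close>

lemma lebesgue_integral_parallelotope:
  fixes p :: "real ^ 'n"
  defines "W \<equiv> (\<lambda>t. p + T t) ` cbox 0 1"
  obtains c where "0 < c"
    "\<And>f :: real ^ 'n \<Rightarrow> real. convex_on W f \<Longrightarrow>
      (LINT x:W|lebesgue. f x) = c * (LINT t:box 0 1|lborel. f (p + T t))"
proof -
  obtain c where c: "0 < c" "distr lborel borel S = density lborel (\<lambda>_. ennreal c)"
    using lborel_distr_S by blast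
  have W: "W = (+) p ` (T ` cbox 0 1)" by (auto simp: W_def)
  have inj: "inj T" by (rule inj_on_inverseI[of _ S]) simp
  have "convex W" unfolding W using linear_T by (intro convex_translation convex_linear_image) auto
  have int: "interior W = (\<lambda>t. p + T t) ` box 0 1"
    unfolding W interior_translation interior_injective_linear_image[OF linear_T inj] interior_cbox
    by (simp add: image_image)
  have "compact W" unfolding W_def
    by (intro compact_continuous_image continuous_intros cont compact_cbox)
  then have fr: "frontier W = W - interior W" by (simp add: frontier_def compact_imp_closed)
  have null: "frontier W \<in> null_sets lebesgue"
    using negligible_convex_frontier[OF \<open>convex W\<close>] by (simp add: negligible_iff_null_sets)
  have "(LINT x:W|lebesgue. f x) = c * (LINT t:box 0 1|lborel. f (p + T t))"
    if f: "convex_on W f" for f :: "real ^ 'n \<Rightarrow> real"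
  proof -
    define G where "G t = indicator (box 0 1) t *\<^sub>R f (p + T t)" for t
    define g where "g x = indicator (interior W) x *\<^sub>R f x" for x
    have cf: "continuous_on (interior W) f"
      by (intro convex_on_continuous convex_on_subset[OF f] interior_subset convex_interior \<open>convex W\<close>) auto
    then have g: "g \<in> borel_measurable borel"
      unfolding g_def by (intro borel_measurable_continuous_on_indicator) auto
    have "continuous_on (box 0 1) (\<lambda>t. f (p + T t))"
      by (rule continuous_on_compose2[OF cf]) (auto simp: int intro!: continuous_intros cont)
    then have G: "G \<in> borel_measurable borel"
      unfolding G_def by (intro borel_measurable_continuous_on_indicator) auto
    have gG: "g x = G (S (- p + x))" for x
    proof -
      have "x = p + T (S (- p + x))" by simp
      moreover have "x \<in> interior W \<longleftrightarrow> S (- p + x) \<in> box 0 1"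
        by (simp add: int image_affine)
      ultimately show ?thesis
        by (cases "x \<in> interior W") (simp_all add: g_def G_def)
    qed
    have g': "g \<in> borel_measurable lebesgue" using g by (simp add: measurable_completion)
    have eq: "indicator W x *\<^sub>R f x = g x" if "x \<notin> frontier W" for x
      using that interior_subset[of W] by (auto simp: fr g_def indicator_def)
    have fm: "(\<lambda>x. indicator W x *\<^sub>R f x) \<in> borel_measurable lebesgue"
      by (rule complete_measure.borel_measurable_cong_null[OF completion.complete_measure_axioms g' null]) (use eq in auto)
    have "(LINT x:W|lebesgue. f x) = (LINT x|lebesgue. g x)"
      unfolding set_lebesgue_integral_def
    proof (rule integral_cong_AE[OF fm g'])
      show "AE x in lebesgue. indicator W x *\<^sub>R f x = g x"
        using AE_not_in[OF null] by eventually_elim (rule eq)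
    qed
    also have "\<dots> = (LINT x|lborel. g x)" using g by (intro integral_completion) simp
    also have "\<dots> = (LINT x|lborel. G (S (- p + x)))" by (simp add: gG)
    also have "\<dots> = (LINT x|distr lborel borel ((+) (- p)). G (S x))"
      using measurable_compose[OF meas(2) G] by (subst integral_distr) auto
    also have "\<dots> = (LINT x|lborel. G (S x))" by (simp only: lborel_distr_plus)
    also have "\<dots> = (LINT t|distr lborel borel S. G t)"
      using G meas(2) by (subst integral_distr) auto
    also have "\<dots> = c * (LINT t|lborel. G t)"
      unfolding c(2) using c(1) G by (subst integral_density) auto
    finally show ?thesis by (simp add: set_lebesgue_integral_def G_def)
  qed
  with c(1) that show ?thesis by blast
qed

lemma frontier_parallelotope:
  "frontier ((\<lambda>t. p + T t) ` cbox 0 1) =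
    (\<Union>(i, s)\<in>UNIV \<times> {0, 1}. (\<lambda>t. p + T t) ` (cbox 0 1 \<inter> {t. t $ i = s}))"
proof -
  let ?W = "(\<lambda>t. p + T t) ` cbox 0 1"
  have W: "?W = (+) p ` (T ` cbox 0 1)" by auto
  have inj: "inj T" by (rule inj_on_inverseI[of _ S]) simp
  have int: "interior ?W = (\<lambda>t. p + T t) ` box 0 1"
    unfolding W interior_translation interior_injective_linear_image[OF linear_T inj] interior_cbox
    by (simp add: image_image)
  have "compact ?W"
    by (intro compact_continuous_image continuous_intros cont compact_cbox)
  then have "frontier ?W = ?W - interior ?W" by (simp add: frontier_def compact_imp_closed)
  also have "\<dots> = ?W - (\<lambda>t. p + T t) ` box 0 1" by (simp only: int)
  also have "\<dots> = (\<lambda>t. p + T t) ` (cbox 0 1 - box 0 1)"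
    unfolding image_affine by auto
  also have "cbox 0 1 - box 0 1 = (\<Union>(i, s)\<in>UNIV \<times> {0, 1}. cbox 0 1 \<inter> {t :: real ^ 'n. t $ i = s})"
    by (auto simp: mem_box_cart less_le)
  finally show ?thesis by (auto simp: image_affine)
qed

text \<open>Reduces every facet to one with \<open>t $ i = 0\<close> and a shifted base point;
  opposite facets thereby get the same \<open>facet_const\<close>.\<close>

lemma facet_translate:
  "(\<lambda>t. p + T t) ` (cbox 0 1 \<inter> {t. t $ i = s}) =
    (\<lambda>t. (p + s *\<^sub>R T (axis i 1)) + T t) ` (cbox 0 1 \<inter> {t. t $ i = 0})" if s: "s \<in> {0..1}"
proof -
  have T_upd: "p + T (upd i s t) = p + s *\<^sub>R T (axis i 1) + T t" if "t $ i = 0" for t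
  proof -
    have "upd i s t = s *\<^sub>R axis i 1 + t" using that by (auto simp: vec_eq_iff axis_def)
    then show ?thesis using linear_T by (simp add: T_add linear_scale)
  qed
  show ?thesis
  proof (intro set_eqI iffI)
    fix x assume "x \<in> (\<lambda>t. p + T t) ` (cbox 0 1 \<inter> {t. t $ i = s})"
    then obtain t where t: "x = p + T t" "t \<in> cbox 0 1" "t $ i = s" by auto
    have "upd i s (upd i 0 t) = t" using t by (simp add: vec_eq_iff)
    then have "x = p + s *\<^sub>R T (axis i 1) + T (upd i 0 t)" using T_upd[of "upd i 0 t"] t by simp
    moreover have "upd i 0 t \<in> cbox 0 1 \<inter> {t. t $ i = 0}" using t upd_cbox[of t 0 i] by simp
    ultimately show "x \<in> (\<lambda>t. (p + s *\<^sub>R T (axis i 1)) + T t) ` (cbox 0 1 \<inter> {t. t $ i = 0})" by blast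
  next
    fix x assume "x \<in> (\<lambda>t. (p + s *\<^sub>R T (axis i 1)) + T t) ` (cbox 0 1 \<inter> {t. t $ i = 0})"
    then obtain t where t: "x = p + s *\<^sub>R T (axis i 1) + T t" "t \<in> cbox 0 1" "t $ i = 0" by auto
    then have "x = p + T (upd i s t)" using T_upd by simp
    moreover have "upd i s t \<in> cbox 0 1 \<inter> {t. t $ i = s}" using t upd_cbox[OF _ s] by simp
    ultimately show "x \<in> (\<lambda>t. p + T t) ` (cbox 0 1 \<inter> {t. t $ i = s})" by blast
  qed
qed

lemma surface_integral_parallelotope:
  fixes p :: "real ^ 'n" and f :: "real ^ 'n \<Rightarrow> real"
  defines "W \<equiv> (\<lambda>t. p + T t) ` cbox 0 1"
  assumes h: "convex_on (cbox 0 1) (\<lambda>t. f (p + T t))"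
  shows "(LINT x:frontier W|surface_measure. f x) =
    (\<Sum>i\<in>UNIV. facet_const i *
      ((LINT t:box 0 1|lborel. f (p + T (upd i 0 t))) + (LINT t:box 0 1|lborel. f (p + T (upd i 1 t)))))"
proof -
  define A where "A = (\<lambda>(i, s). (\<lambda>t. p + T t) ` (cbox 0 1 \<inter> {t. t $ i = s}))"
  let ?I = "UNIV \<times> {0, 1 :: real} :: ('n \<times> real) set"
  obtain b where b: "\<And>t. t \<in> cbox 0 1 \<Longrightarrow> \<bar>f (p + T t)\<bar> \<le> b"
    using convex_on_cube_bounded[OF h] by blast
  have facet: "set_integrable surface_measure (A (i, s)) f"
    "(LINT x:A (i, s)|surface_measure. f x) = facet_const i * (LINT t:box 0 1|lborel. f (p + T (upd i s t)))"
    if s: "s \<in> {0..1}" for i s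
  proof -
    let ?q = "p + s *\<^sub>R T (axis i 1)"
    have A: "A (i, s) = (\<lambda>t. ?q + T t) ` (cbox 0 1 \<inter> {t. t $ i = 0})"
      using facet_translate[OF s] by (simp add: A_def)
    have upd: "?q + T (upd i 0 t) = p + T (upd i s t)" for t
    proof -
      have "upd i s t = s *\<^sub>R axis i 1 + upd i 0 t" by (auto simp: vec_eq_iff axis_def)
      then show ?thesis using linear_T by (simp add: T_add linear_scale)
    qed
    have cont: "continuous_on {t. \<forall>j\<in>-{i}. 0 < t $ j \<and> t $ j < 1} (\<lambda>t. f (?q + T (upd i 0 t)))"
      unfolding upd using continuous_on_upd_convex[OF h s, of i] .
    have bdd: "\<bar>f x\<bar> \<le> b" if "x \<in> (\<lambda>t. ?q + T t) ` (cbox 0 1 \<inter> {t. t $ i = 0})" for x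
      using that b unfolding A[symmetric] by (auto simp: A_def)
    show "set_integrable surface_measure (A (i, s)) f"
      unfolding A by (rule facet_integral(1)[OF cont bdd])
    show "(LINT x:A (i, s)|surface_measure. f x) = facet_const i * (LINT t:box 0 1|lborel. f (p + T (upd i s t)))"
      unfolding A using facet_integral(2)[OF cont bdd] unfolding upd .
  qed
  have sets: "A (i, s) \<in> sets surface_measure" for i s
    unfolding A_def prod.case by (intro affine_sets_hausdorff sets.Int hyperplane_borel) auto
  have "frontier W = (\<Union>k\<in>?I. A k)"
    unfolding W_def frontier_parallelotope A_def ..
  then have "(LINT x:frontier W|surface_measure. f x) = (LINT x:(\<Union>k\<in>?I. A k)|surface_measure. f x)"
    by simp
  also have "\<dots> = (\<Sum>k\<in>?I. LINT x:A k|surface_measure. f x)"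
  proof (rule set_integral_finite_UN_AE)
    fix k l assume k: "k \<in> ?I" and l: "l \<in> ?I"
    obtain i s where k': "k = (i, s)" by (cases k)
    obtain j r where l': "l = (j, r)" by (cases l)
    show "AE x in surface_measure. x \<in> A k \<and> x \<in> A l \<longrightarrow> k = l"
    \<comment> \<open>Distinct parallel facets are disjoint. Facets in different directions meet
      inside the null set \<open>?N\<close>.\<close>
    proof (cases "i = j")
      case True
      then show ?thesis by (auto simp: A_def k' l' image_affine)
    next
      case False
      have s: "s \<in> {0..1}" using k k' by auto
      let ?N = "(\<lambda>t. p + s *\<^sub>R T (axis i 1) + T t) ` ({t. t $ j = r} \<inter> {t. t $ i = 0})"
      have "AE x in surface_measure. x \<notin> ?N"
        using False by (intro AE_not_in null_facet_boundary) auto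
      then show ?thesis
      proof eventually_elim
        case (elim x)
        show ?case
        proof (rule impI, rule ccontr)
          assume x: "x \<in> A k \<and> x \<in> A l"
          then obtain t where t: "x = p + s *\<^sub>R T (axis i 1) + T t" "t $ i = 0"
            using facet_translate[OF s] by (auto simp: k' A_def)
          have "upd i s t = s *\<^sub>R axis i 1 + t" using t by (auto simp: vec_eq_iff axis_def)
          then have "x = p + T (upd i s t)" using linear_T t by (simp add: T_add linear_scale)
          moreover obtain t' where "x = p + T t'" "t' $ j = r" using x by (auto simp: l' A_def)
          ultimately have "upd i s t $ j = r" by (metis ST add_left_cancel)
          then have "t $ j = r" using False by simp
          then show False using elim t by blast
        qed
      qed
    qed
  qed (use sets facet in auto)
  also have "\<dots> = (\<Sum>i\<in>UNIV. \<Sum>s\<in>{0,1}. LINT x:A (i, s)|surface_measure. f x)"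
    unfolding sum.cartesian_product by (rule sum.cong) auto
  also have "\<dots> = (\<Sum>i\<in>UNIV. facet_const i *
      ((LINT t:box 0 1|lborel. f (p + T (upd i 0 t))) + (LINT t:box 0 1|lborel. f (p + T (upd i 1 t)))))"
  proof (rule sum.cong)
    show "(\<Sum>s\<in>{0,1}. LINT x:A (i, s)|surface_measure. f x) = facet_const i *
        ((LINT t:box 0 1|lborel. f (p + T (upd i 0 t))) + (LINT t:box 0 1|lborel. f (p + T (upd i 1 t))))" for i
      using facet(2)[of 0 i] facet(2)[of 1 i] by (simp add: algebra_simps)
  qed simp
  finally show ?thesis .
qed

section \<open>Comparison of the two means\<close>

lemma jensen_type_parallelotope: "jensen_type ((\<lambda>t. p + T t) ` cbox 0 1)"
proof -
  let ?W = "(\<lambda>t. p + T t) ` cbox 0 1"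
  have W: "?W = (+) p ` (T ` cbox 0 1)" by auto
  have conv: "convex ?W" unfolding W using linear_T by (intro convex_translation convex_linear_image) auto
  have comp: "compact ?W"
    by (intro compact_continuous_image continuous_intros cont compact_cbox)
  have one: "(LINT t:box 0 (1 :: real ^ 'n)|lborel. 1 :: real) = 1"
    using emeasure_lborel_unit_box[of "box 0 (1 :: real ^ 'n)"]
    by (simp add: set_lebesgue_integral_def measure_def box_subset_cbox)
  have meas: "measure M A = (LINT x:A|M. 1)" if "A \<in> sets M" for A and M :: "(real ^ 'n) measure"
    using that sets.sets_into_space[OF that] by (simp add: set_lebesgue_integral_def Int_absorb2)
  have fr: "frontier ?W \<in> sets surface_measure"
    using sets_borel_subset_hausdorff[of "CARD('n) - 1"] by (auto intro: borel_closed)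
  have ineq: "1 / measure lebesgue ?W * (LINT x:?W|lebesgue. f x)
      \<le> 1 / measure surface_measure (frontier ?W) * (LINT x:frontier ?W|surface_measure. f x)"
    if f: "convex_on ?W f" for f :: "real ^ 'n \<Rightarrow> real"
  proof -
    obtain c where c: "0 < c" "\<And>f :: real ^ 'n \<Rightarrow> real. convex_on ?W f \<Longrightarrow>
        (LINT x:?W|lebesgue. f x) = c * (LINT t:box 0 1|lborel. f (p + T t))"
      using lebesgue_integral_parallelotope[of p] by blast
    have const: "convex_on ?W (\<lambda>_. 1)" "convex_on (cbox 0 1) (\<lambda>_ :: real ^ 'n. 1)"
      using conv by (auto intro!: convex_onI simp: algebra_simps)
    have h: "convex_on (cbox 0 1) (\<lambda>t. f (p + T t))"
    proof (rule convex_onI)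
      fix u :: real and x y :: "real ^ 'n" assume u: "0 < u" "u < 1" "x \<in> cbox 0 1" "y \<in> cbox 0 1"
      have "T ((1 - u) *\<^sub>R x + u *\<^sub>R y) = (1 - u) *\<^sub>R T x + u *\<^sub>R T y"
        using linear_T by (simp add: T_add linear_scale)
      then have "p + T ((1 - u) *\<^sub>R x + u *\<^sub>R y) = (1 - u) *\<^sub>R (p + T x) + u *\<^sub>R (p + T y)"
        by (simp add: algebra_simps)
      then show "f (p + T ((1 - u) *\<^sub>R x + u *\<^sub>R y)) \<le> (1 - u) * f (p + T x) + u * f (p + T y)"
        using convex_onD[OF f, of u "p + T x" "p + T y"] u by simp
    qed auto
    define I where "I = (LINT t:box 0 1|lborel. f (p + T t))"
    define J where "J i = (LINT t:box 0 1|lborel. f (p + T (upd i 0 t))) + (LINT t:box 0 1|lborel. f (p + T (upd i 1 t)))"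
      for i
    define w where "w = (\<Sum>i\<in>UNIV. facet_const i)"
    have w: "0 < w" unfolding w_def using facet_const_pos by (intro sum_pos) auto
    \<comment> \<open>Constants are convex, so both integral formulas apply to the function 1 and
      give the volume and the surface. The factor 2 in \<open>mF\<close> counts the pair of facets
      in each direction.\<close>
    have mW: "measure lebesgue ?W = c"
      using c(2)[OF const(1)] comp one by (subst meas) (auto simp: lmeasurable_compact fmeasurableD)
    have mF: "measure surface_measure (frontier ?W) = 2 * w"
      unfolding meas[OF fr] w_def
      using surface_integral_parallelotope[of "\<lambda>_. 1" p] const one
      by (simp add: sum_distrib_left mult.commute)
    have IJ: "2 * I \<le> J i" for i
      unfolding I_def J_def using integral_cube_le_facets[OF h] .
    have "2 * w * I = (\<Sum>i\<in>UNIV. facet_const i * (2 * I))"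
      by (simp add: w_def sum_distrib_left sum_distrib_right algebra_simps)
    also have "\<dots> \<le> (\<Sum>i\<in>UNIV. facet_const i * J i)"
      by (intro sum_mono mult_left_mono IJ less_imp_le facet_const_pos)
    finally have "I \<le> 1 / (2 * w) * (\<Sum>i\<in>UNIV. facet_const i * J i)"
      using w by (simp add: field_simps)
    then show ?thesis
      using c(1) unfolding mW mF c(2)[OF f] surface_integral_parallelotope[OF h] I_def[symmetric] J_def[symmetric]
      by simp
  qed
  show ?thesis
    unfolding jensen_type_def using conv comp ineq by (auto intro: compact_imp_closed)
qed

end

theorem proposition1:
  fixes W :: "(real ^ 'n) set"
  assumes "parallelotope W"
  shows "jensen_type W"
proof -
  obtain p :: "real ^ 'n" and u :: "'n \<Rightarrow> real ^ 'n" where u: "inj u" "independent (range u)"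
    and W: "W = {p + (\<Sum>i\<in>UNIV. t i *\<^sub>R u i) | t :: 'n \<Rightarrow> real. \<forall>i. t i \<in> {0..1}}"
    using assms by (auto simp: parallelotope_def)
  define T where "T t = (\<Sum>i\<in>UNIV. t $ i *\<^sub>R u i)" for t :: "real ^ 'n"
  have lin: "linear T"
    by (rule linearI) (simp_all add: T_def algebra_simps sum.distrib scaleR_sum_right)
  have "t = 0" if "T t = 0" for t
  proof -
    \<comment> \<open>Independence speaks of the set \<open>range u\<close>; injectivity of
      \<open>u\<close> lets each vector carry the coefficient of its own index.\<close>
    have "(\<Sum>v\<in>range u. t $ (inv u v) *\<^sub>R v) = T t"
      by (subst sum.reindex[OF u(1)]) (simp add: T_def u(1))
    then have "\<forall>v\<in>range u. t $ (inv u v) = 0"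
      using u(2) that unfolding independent_explicit by auto
    then show ?thesis using u(1) by (auto simp: vec_eq_iff)
  qed
  then have "inj T" by (simp add: linear_injective_0[OF lin])
  then obtain S where S: "linear S" "\<And>x. S (T x) = x" "\<And>x. T (S x) = x"
    using linear_injective_isomorphism[OF lin] by metis
  interpret linear_iso T S by (rule linear_iso.intro[OF lin S(1) S(3) S(2)])
  have "W = (\<lambda>t. p + T t) ` cbox 0 1"
  proof (intro set_eqI iffI)
    fix x assume "x \<in> W"
    then obtain t where t: "x = p + (\<Sum>i\<in>UNIV. t i *\<^sub>R u i)" "\<forall>i. t i \<in> {0..1}" using W by auto
    then have "x = p + T (\<chi> i. t i)" "(\<chi> i. t i) \<in> cbox 0 1" by (auto simp: T_def mem_box_cart)
    then show "x \<in> (\<lambda>t. p + T t) ` cbox 0 1" by blast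
  next
    fix x assume "x \<in> (\<lambda>t. p + T t) ` cbox 0 1"
    then show "x \<in> W" by (force simp: W T_def mem_box_cart)
  qed
  then show ?thesis using jensen_type_parallelotope by simp
qed

end
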